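(* Fix $\beta>0$. There is a constant $C$ (independent of $n$, possibly different in each line) such that the interpolation projection operator $\mathcal R_n$ satisfies the following estimates for all integers $n>1$: 1. $\|\mathcal R_n\|_{C_0^0(\mathbb R)\to C_0^0(\mathbb R)}\le C\log n$; 2. $\|\mathcal R_n\|_{C_0^0(\mathbb R)\to L^2(\mathbb R)}\le C\,n\log n$; 3. $\|\mathcal R_n\|_{C_0^0(\mathbb R)\to H^1(\mathbb R)}\le C\,n^{3/2}$; and hence 4. $\|\mathcal R_n\|_{H^1(\mathbb R)\to H^1(\mathbb R)}\le C\,n^{3/2}$.
   Context: $\|\cdot\|_{X\to Y}$ denotes the operator norm. $C_0^0(\mathbb R)$ is the space of continuous $f:\mathbb R\to\mathbb C$ with $f(x)\to0$ as $|x|\to\infty$, with the supremum norm. With $\mathcal F f(k)=\int_{\mathbb R}e^{-ikx}f(x)\,dx$, $H^1(\mathbb R)$ is the space of $f\in L^2(\mathbb R)$ with $\|f\|_{H^1(\mathbb R)}=\big(\int_{\mathbb R}(1+|k|)^{2}|\mathcal F f(k)|^2dk\big)^{1/2}<\infty$; elements of $H^1(\mathbb R)$ are identified with their continuous representatives, which lie in $C_0^0(\mathbb R)$. For $\beta>0$ let $M_\beta(z)=\frac{z-i\beta}{z+i\beta}$, $M_\beta^{-1}(z)=\frac{\beta}{i}\frac{z+1}{z-1}$, and $T(\theta)=M_\beta^{-1}(e^{i\theta})$, a bijection from $(0,2\pi)$ to $\mathbb R$. For $f\in C_0^0(\mathbb R)$ put $F(\theta)=f(T(\theta))$ for $\theta\in(0,2\pi)$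 and $F(0)=F(2\pi)=0$. For $n\in\mathbb N$ let $\theta_\ell=2\pi\ell/n$ ($\ell=0,\dots,n-1$), $n_+=\lfloor n/2\rfloor$, $n_-=\lfloor(n-1)/2\rfloor$, $\tilde F_k=\frac1n\sum_{\ell=0}^{n-1}e^{-ik\theta_\ell}F(\theta_\ell)$, and $\mathcal I_nF(\theta)=\sum_{k=-n_-}^{n_+}e^{ik\theta}\tilde F_k$ (the trigonometric interpolant of $F$ at the $\theta_\ell$). The operator $\mathcal R_n$ is defined by $\mathcal R_nf(x)=\mathcal I_nF(T^{-1}(x))=\sum_{k=-n_-}^{n_+}\tilde F_k\,M_\beta(x)^k$. *)

theory Defs
  imports "HOL-Analysis.Analysis"
begin

definition C0_space :: "(real \<Rightarrow> complex) set" where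
  "C0_space = {f. continuous_on UNIV f \<and> (f \<longlongrightarrow> 0) at_infinity}"

definition sup_norm :: "(real \<Rightarrow> complex) \<Rightarrow> real" where
  "sup_norm f = (SUP x. norm (f x))"

text \<open>Elements of \<open>L2_space\<close> are functions, not classes modulo equality almost everywhere.\<close>

definition L2_space :: "(real \<Rightarrow> complex) set" where
  "L2_space = {f \<in> borel_measurable lborel. integrable lborel (\<lambda>x. (norm (f x))\<^sup>2)}"

definition L2_norm :: "(real \<Rightarrow> complex) \<Rightarrow> real" where
  "L2_norm f = sqrt (LINT x|lborel. (norm (f x))\<^sup>2)"

text \<open>The integral \<open>\<integral> exp (-\<i>kx) f x dx\<close> need not converge absolutely for square-integrable \<open>f\<close>,
  so the Fourier transform is taken in Plancherel's sense: it is the limit in the mean of the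
  transforms of the truncations of \<open>f\<close> to \<open>{-r..r}\<close>. It is unique up to null sets, and agrees almost
  everywhere with the integral if \<open>f\<close> is also integrable.\<close>

definition fourier_trunc :: "(real \<Rightarrow> complex) \<Rightarrow> real \<Rightarrow> real \<Rightarrow> complex" where
  "fourier_trunc f r k = (LINT x:{-r..r}|lborel. exp (- \<i> * of_real k * of_real x) * f x)"

definition is_fourier_L2 :: "(real \<Rightarrow> complex) \<Rightarrow> (real \<Rightarrow> complex) \<Rightarrow> bool" where
  "is_fourier_L2 f g \<longleftrightarrow> g \<in> L2_space \<and>
     ((\<lambda>r. \<integral>\<^sup>+ k. ennreal ((norm (fourier_trunc f r k - g k))\<^sup>2) \<partial>lborel) \<longlongrightarrow> 0) at_top"

definition fourier_L2 :: "(real \<Rightarrow> complex) \<Rightarrow> real \<Rightarrow> complex" where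
  "fourier_L2 f = (SOME g. is_fourier_L2 f g)"

text \<open>\<open>H1_space\<close> consists of the continuous representatives. Integrability of the weighted transform
  does not depend on which version \<open>g\<close> of the transform is chosen.\<close>

definition H1_space :: "(real \<Rightarrow> complex) set" where
  "H1_space = {f \<in> L2_space. continuous_on UNIV f \<and>
     (\<exists>g. is_fourier_L2 f g \<and> integrable lborel (\<lambda>k. (1 + \<bar>k\<bar>)\<^sup>2 * (norm (g k))\<^sup>2))}"

definition H1_norm :: "(real \<Rightarrow> complex) \<Rightarrow> real" where
  "H1_norm f = sqrt (LINT k|lborel. (1 + \<bar>k\<bar>)\<^sup>2 * (norm (fourier_L2 f k))\<^sup>2)"

text \<open>Operator norm of \<open>A\<close> from the space \<open>X\<close> to the space \<open>Y\<close>; it is \<open>\<infinity>\<close> if \<open>A\<close> is unbounded or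
  does not map \<open>X\<close> into \<open>Y\<close>, so a finite bound on it includes the mapping property.\<close>

definition op_norm ::
  "'a set \<Rightarrow> ('a \<Rightarrow> real) \<Rightarrow> 'b set \<Rightarrow> ('b \<Rightarrow> real) \<Rightarrow> ('a \<Rightarrow> 'b) \<Rightarrow> ennreal" where
  "op_norm X normX Y normY A =
     (if A ` X \<subseteq> Y then (SUP f\<in>{f \<in> X. normX f \<le> 1}. ennreal (normY (A f))) else \<infinity>)"

definition moebius_map :: "real \<Rightarrow> complex \<Rightarrow> complex" where
  "moebius_map \<beta> z = (z - \<i> * of_real \<beta>) / (z + \<i> * of_real \<beta>)"

definition moebius_map_inv :: "real \<Rightarrow> complex \<Rightarrow> complex" where
  "moebius_map_inv \<beta> z = of_real \<beta> / \<i> * ((z + 1) / (z - 1))"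

text \<open>\<open>Re\<close> only adjusts the type: \<open>moebius_map_inv \<beta> (exp (\<i>\<theta>))\<close> is real, see \<open>of_real_circle_to_line\<close>.\<close>

definition circle_to_line :: "real \<Rightarrow> real \<Rightarrow> real" where
  "circle_to_line \<beta> \<theta> = Re (moebius_map_inv \<beta> (exp (\<i> * of_real \<theta>)))"

definition line_to_circle :: "real \<Rightarrow> real \<Rightarrow> real" where
  "line_to_circle \<beta> = the_inv_into {0<..<2*pi} (circle_to_line \<beta>)"

definition lift_to_circle :: "real \<Rightarrow> (real \<Rightarrow> complex) \<Rightarrow> real \<Rightarrow> complex" where
  "lift_to_circle \<beta> f \<theta> = (if 0 < \<theta> \<and> \<theta> < 2*pi then f (circle_to_line \<beta> \<theta>) else 0)"

definition node :: "nat \<Rightarrow> nat \<Rightarrow> real" where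
  "node n l = 2 * pi * real l / real n"

definition discrete_fourier :: "nat \<Rightarrow> (real \<Rightarrow> complex) \<Rightarrow> int \<Rightarrow> complex" where
  "discrete_fourier n F k =
     1 / of_nat n * (\<Sum>l<n. exp (- \<i> * of_int k * of_real (node n l)) * F (node n l))"

definition trig_interp :: "nat \<Rightarrow> (real \<Rightarrow> complex) \<Rightarrow> real \<Rightarrow> complex" where
  "trig_interp n F \<theta> =
     (\<Sum>k = - int ((n - 1) div 2)..int (n div 2).
        exp (\<i> * of_int k * of_real \<theta>) * discrete_fourier n F k)"

definition interp_op :: "real \<Rightarrow> nat \<Rightarrow> (real \<Rightarrow> complex) \<Rightarrow> real \<Rightarrow> complex" where
  "interp_op \<beta> n f x = trig_interp n (lift_to_circle \<beta> f) (line_to_circle \<beta> x)"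

lemma exp_ne_1:
  assumes "0 < \<theta>" "\<theta> < 2*pi"
  shows "exp (\<i> * of_real \<theta>) \<noteq> 1"
proof
  assume "exp (\<i> * of_real \<theta>) = 1"
  then have "Re (exp (\<i> * of_real \<theta>)) = 1" by simp
  then have "cos \<theta> = 1" by (simp add: Re_exp)
  then obtain m :: int where "\<theta> = m * (2*pi)"
    using cos_one_2pi_int by (metis mult.commute mult.assoc)
  with assms have "0 < real_of_int m" "real_of_int m < 1"
    by (auto simp: zero_less_mult_iff)
  then have "0 < m" "m < 1" by simp_all
  then show False by simp
qed

lemma of_real_circle_to_line:
  assumes "0 < \<theta>" "\<theta> < 2*pi"
  shows "of_real (circle_to_line \<beta> \<theta>) = moebius_map_inv \<beta> (exp (\<i> * of_real \<theta>))"
proof -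
  let ?w = "exp (\<i> * of_real \<theta>)"
  have w: "cnj ?w = inverse ?w"
    by (simp add: exp_cnj exp_minus)
  have aux: "- ((inverse z + 1) / (inverse z - 1)) = (z + 1) / (z - 1)"
    if "z \<noteq> 0" "z \<noteq> 1" for z :: complex
    using that by (simp add: divide_simps) (simp add: algebra_simps)
  have "cnj (moebius_map_inv \<beta> ?w) = of_real \<beta> / \<i> * (- ((inverse ?w + 1) / (inverse ?w - 1)))"
    by (simp add: moebius_map_inv_def w)
  also have "\<dots> = moebius_map_inv \<beta> ?w"
    by (subst aux) (use exp_ne_1[OF assms] in \<open>auto simp: moebius_map_inv_def\<close>)
  finally have "moebius_map_inv \<beta> ?w \<in> \<real>"
    by (simp add: Reals_cnj_iff)
  then show ?thesis
    unfolding circle_to_line_def by simp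
qed

lemma moebius_map_moebius_map_inv:
  assumes "\<beta> > 0" "z \<noteq> 1"
  shows "moebius_map \<beta> (moebius_map_inv \<beta> z) = z"
proof -
  let ?b = "\<i> * complex_of_real \<beta>"
  have i: "moebius_map_inv \<beta> z = - ?b * (z + 1) / (z - 1)"
    by (simp add: moebius_map_inv_def)
  have e: "moebius_map_inv \<beta> z - ?b = - 2 * ?b * z / (z - 1)"
    "moebius_map_inv \<beta> z + ?b = - 2 * ?b / (z - 1)"
    unfolding i using assms by (simp_all add: divide_simps) (simp_all add: algebra_simps)
  then show ?thesis
    unfolding moebius_map_def e using assms by simp
qed

lemma moebius_map_inv_moebius:
  assumes "\<beta> > 0"
  shows "moebius_map_inv \<beta> (moebius_map \<beta> (of_real x)) = of_real x"
proof -
  let ?b = "\<i> * complex_of_real \<beta>" and ?x = "complex_of_real x"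
  have nz: "?x + ?b \<noteq> 0"
    using assms by (auto simp: complex_eq_iff)
  have e: "moebius_map \<beta> ?x + 1 = 2 * ?x / (?x + ?b)"
    "moebius_map \<beta> ?x - 1 = - 2 * ?b / (?x + ?b)"
    unfolding moebius_map_def using nz by (simp_all add: divide_simps)
  show ?thesis
    unfolding moebius_map_inv_def e using assms nz by simp
qed

lemma moebius_circle_to_line:
  assumes "\<beta> > 0" "0 < \<theta>" "\<theta> < 2*pi"
  shows "moebius_map \<beta> (of_real (circle_to_line \<beta> \<theta>)) = exp (\<i> * of_real \<theta>)"
  using assms by (simp add: of_real_circle_to_line moebius_map_moebius_map_inv exp_ne_1)

lemma bij_betw_circle_to_line:
  assumes "\<beta> > 0"
  shows "bij_betw (circle_to_line \<beta>) {0<..<2*pi} UNIV"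
  unfolding bij_betw_def
proof (intro conjI inj_onI equalityI subsetI UNIV_I)
  fix s t assume st: "s \<in> {0<..<2*pi}" "t \<in> {0<..<2*pi}"
    and "circle_to_line \<beta> s = circle_to_line \<beta> t"
  then have "exp (\<i> * of_real s) = exp (\<i> * of_real t)"
    using moebius_circle_to_line[OF assms] by (metis greaterThanLessThan_iff)
  moreover have "Arg2pi (exp (\<i> * of_real u)) = u" if "u \<in> {0<..<2*pi}" for u
    using that by (intro Arg2pi_unique[where r = 1]) auto
  ultimately show "s = t"
    using st by metis
next
  fix x :: real
  let ?z = "moebius_map \<beta> (of_real x)"
  define t where "t = Arg2pi ?z"
  have nz: "complex_of_real x + \<i> * of_real \<beta> \<noteq> 0"
    using assms by (auto simp: complex_eq_iff)
  have "cmod ?z = 1"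
  proof -
    have "cmod (of_real x - \<i> * of_real \<beta>) = cmod (of_real x + \<i> * of_real \<beta>)"
      by (simp add: cmod_def)
    then show ?thesis
      using nz by (simp add: moebius_map_def norm_divide)
  qed
  then have z: "?z = exp (\<i> * of_real t)"
    using Arg2pi_eq[of ?z] by (simp add: t_def)
  have "?z \<noteq> 1"
    using assms nz by (simp add: moebius_map_def divide_simps)
  then have "t \<noteq> 0"
    using z by auto
  then have t: "0 < t" "t < 2*pi"
    using Arg2pi_ge_0[of ?z] Arg2pi_lt_2pi[of ?z] by (auto simp: t_def)
  have "complex_of_real (circle_to_line \<beta> t) = of_real x"
    unfolding of_real_circle_to_line[OF t] z[symmetric] by (rule moebius_map_inv_moebius[OF assms])
  then show "x \<in> circle_to_line \<beta> ` {0<..<2*pi}"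
    using t by (auto intro!: image_eqI[of _ _ t])
qed

lemma interp_op_eq:
  assumes "\<beta> > 0"
  shows "interp_op \<beta> n f x =
    (\<Sum>k = - int ((n - 1) div 2)..int (n div 2).
       discrete_fourier n (lift_to_circle \<beta> f) k * moebius_map \<beta> (of_real x) powi k)"
proof -
  define t where "t = line_to_circle \<beta> x"
  have b: "inj_on (circle_to_line \<beta>) {0<..<2*pi}" "x \<in> circle_to_line \<beta> ` {0<..<2*pi}"
    using bij_betw_circle_to_line[OF assms] by (auto simp: bij_betw_def)
  have t: "t \<in> {0<..<2*pi}" "circle_to_line \<beta> t = x"
    using the_inv_into_into[OF b order_refl] f_the_inv_into_f[OF b]
    by (simp_all add: t_def line_to_circle_def)
  have m: "moebius_map \<beta> (of_real x) = exp (\<i> * of_real t)"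
    using moebius_circle_to_line[OF assms, of t] t by auto
  have "exp (\<i> * of_int k * of_real t) = exp (\<i> * of_real t) powi k" for k :: int
    by (simp add: exp_power_int mult_ac)
  then show ?thesis
    unfolding interp_op_def trig_interp_def t_def[symmetric] m by (simp add: mult.commute)
qed

end

theory Submission
  imports Defs "HOL-Probability.Characteristic_Functions" "HOL-Probability.Sinc_Integral"
begin

text \<open>Write \<open>h = \<Sum>k. c k * M ^ k\<close> for the interpolant of \<open>f\<close>, where \<open>\<bar>f\<bar> \<le> 1\<close> and \<open>\<bar>M\<bar> = 1\<close> on the line. The partial
  sums of the trigonometric interpolant are bounded by a multiple of the harmonic number of \<open>n\<close>, as
  \<open>\<bar>\<Sum>k. exp (\<i> k t)\<bar> \<le> min n (1 / \<bar>sin (t/2)\<bar>)\<close>. Since \<open>F 0 = 0\<close>, the \<open>c k\<close> sum to \<open>0\<close>, so summation by parts gives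
  \<open>\<bar>h\<bar> \<le> n * O(log n) * \<bar>M - 1\<bar>\<close>, and \<open>M - 1\<close> is square integrable. For \<open>h'\<close>, the powers of \<open>M\<close> are orthogonal with
  respect to \<open>2 \<beta> / (x\<^sup>2 + \<beta>\<^sup>2)\<close>, which is \<open>M' / (\<i> M)\<close>; with \<open>\<bar>c k\<bar> \<le> 1\<close> this yields \<open>\<parallel>h'\<parallel>\<^sup>2 = O(n\<^sup>3)\<close>. The
  \<open>H\<^sup>1\<close> norm of \<open>h\<close> is controlled by \<open>\<parallel>h\<parallel>\<close> and \<open>\<parallel>h'\<parallel>\<close> through Plancherel's identity for the explicit transforms of
  \<open>M ^ k - 1\<close>, which are sums of functions \<open>k ^ m * exp (- \<beta> k)\<close> on a half line. Finally the \<open>H\<^sup>1\<close> norm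
  dominates the supremum norm.\<close>

section \<open>The Plancherel identity\<close>

text \<open>The transform behind \<open>H1_norm\<close> is a chosen limit in the mean, so nothing
  can be computed from it directly. For interpolants \<open>h\<close> this is met by exhibiting a
  \<open>u\<close> whose ordinary integral transform is \<open>h\<close>; the limit in the mean is
  then \<open>2 * pi * u\<close> almost everywhere, and Plancherel for bounded integrable functions
  continuous off a null set suffices. A single power of \<open>M\<close> has modulus 1 and is not
  square integrable. The vanishing sum of the coefficients permits replacing \<open>M ^ k\<close> by
  \<open>M ^ k - 1\<close>, and it also removes the boundary term of the summation by parts. In the
  H1 estimates the squared L2 part is O(n^2 log^2 n), which the n^3 of the derivative absorbs; hence
  no logarithm there. The Sobolev bound concerns general elements of H1, for which no such
  \<open>u\<close> is at hand, and therefore goes through Gaussian averages of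
  \<open>f\<close>.\<close>

lemma borel_measurable_cnj [measurable (raw)]:
  assumes "f \<in> borel_measurable M"
  shows "(\<lambda>x. cnj (f x)) \<in> borel_measurable M"
  by (rule measurable_compose[OF assms borel_measurable_continuous_onI]) (intro continuous_intros)

lemma (in pair_sigma_finite) integrable_prod_bounded:
  fixes u :: "'a \<Rightarrow> complex" and v :: "'b \<Rightarrow> complex"
  assumes [measurable]: "integrable M1 u" "integrable M2 v"
    and K [measurable]: "case_prod K \<in> borel_measurable (M1 \<Otimes>\<^sub>M M2)"
    and B: "\<And>x y. norm (K x y) \<le> B"
  shows "integrable (M1 \<Otimes>\<^sub>M M2) (\<lambda>(x, y). u x * (v y * K x y))"
proof (rule Fubini_integrable)
  have B0: "B \<ge> 0"
    using B[of undefined undefined] norm_ge_zero order_trans by blast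
  have bd: "norm (v y * K x y) \<le> norm (B *\<^sub>R norm (v y))" for x y
    using mult_left_mono[OF B norm_ge_zero, of "v y" x y] B0
    by (simp add: norm_mult abs_mult mult.commute[of B])
  show "(\<lambda>(x, y). u x * (v y * K x y)) \<in> borel_measurable (M1 \<Otimes>\<^sub>M M2)"
    by measurable
  have int: "integrable M2 (\<lambda>y. v y * K x y)" if "x \<in> space M1" for x
  proof (rule Bochner_Integration.integrable_bound[of _ "\<lambda>y. B *\<^sub>R norm (v y)"])
    have "K x \<in> borel_measurable M2"
      using measurable_Pair2[OF K that] by simp
    then show "(\<lambda>y. v y * K x y) \<in> borel_measurable M2"
      using assms by measurable
  qed (use assms bd in auto)
  then show "AE x in M1. integrable M2 (\<lambda>y. case (x, y) of (x, y) \<Rightarrow> u x * (v y * K x y))"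
    by auto
  show "integrable M1 (\<lambda>x. \<integral>y. norm (case (x, y) of (x, y) \<Rightarrow> u x * (v y * K x y)) \<partial>M2)"
  proof (rule Bochner_Integration.integrable_bound[of _ "\<lambda>x. (B * (\<integral>y. norm (v y) \<partial>M2)) *\<^sub>R norm (u x)"])
    show "AE x in M1. norm (\<integral>y. norm (case (x, y) of (x, y) \<Rightarrow> u x * (v y * K x y)) \<partial>M2)
        \<le> norm ((B * (\<integral>y. norm (v y) \<partial>M2)) *\<^sub>R norm (u x))"
    proof (rule AE_I2)
      fix x assume x: "x \<in> space M1"
      have "(\<integral>y. norm (v y * K x y) \<partial>M2) \<le> (\<integral>y. B * norm (v y) \<partial>M2)"
        using bd[of _ x] B0 assms int[OF x] by (intro integral_mono) auto
      then have "norm (u x) * (\<integral>y. norm (v y * K x y) \<partial>M2) \<le> norm (u x) * (B * (\<integral>y. norm (v y) \<partial>M2))"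
        by (intro mult_left_mono) auto
      then show "norm (\<integral>y. norm (case (x, y) of (x, y) \<Rightarrow> u x * (v y * K x y)) \<partial>M2)
          \<le> norm ((B * (\<integral>y. norm (v y) \<partial>M2)) *\<^sub>R norm (u x))"
        using B0 by (simp add: norm_mult[of "u x"] abs_mult mult_ac)
    qed
  qed (use assms in \<open>auto simp: case_prod_beta'\<close>)
qed

text \<open>Every exchange of a space and a frequency integral goes through this form: two
  integrable factors and a bounded kernel. The kernel is an exponential, sometimes multiplied by a
  transform that an L1 norm bounds.\<close>

lemma (in pair_sigma_finite) Fubini_bounded:
  fixes u :: "'a \<Rightarrow> complex" and v :: "'b \<Rightarrow> complex"
  assumes "integrable M1 u" "integrable M2 v"
    and "case_prod K \<in> borel_measurable (M1 \<Otimes>\<^sub>M M2)"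
    and "\<And>x y. norm (K x y) \<le> B"
  shows "(\<integral>x. u x * (\<integral>y. v y * K x y \<partial>M2) \<partial>M1) = (\<integral>y. v y * (\<integral>x. u x * K x y \<partial>M1) \<partial>M2)"
proof -
  have "(\<integral>y. (\<integral>x. u x * (v y * K x y) \<partial>M1) \<partial>M2) = (\<integral>x. (\<integral>y. u x * (v y * K x y) \<partial>M2) \<partial>M1)"
    by (rule Fubini_integral[OF integrable_prod_bounded[OF assms]])
  moreover have "(\<integral>x. u x * (v y * K x y) \<partial>M1) = v y * (\<integral>x. u x * K x y \<partial>M1)" for y
    by (simp flip: integral_mult_right_zero add: mult_ac)
  ultimately show ?thesis
    by simp
qed

text \<open>The sign is that of \<open>char\<close> and of Fourier synthesis: \<open>u\<close> is
  the amplitude and \<open>fourier_integral u\<close> the function on the line. The transform of the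
  theorem is the value at \<open>- k\<close>, and undoing the synthesis costs a factor 2 pi.\<close>

definition fourier_integral :: "(real \<Rightarrow> complex) \<Rightarrow> real \<Rightarrow> complex" where
  "fourier_integral u k = (\<integral>y. u y * iexp (k * y) \<partial>lborel)"

lemma integrable_iexp_mult:
  fixes u :: "real \<Rightarrow> complex"
  assumes "integrable lborel u"
  shows "integrable lborel (\<lambda>y. u y * iexp (k * y))"
  by (rule Bochner_Integration.integrable_bound[OF assms]) (use assms in \<open>auto simp: norm_mult\<close>)

lemma fourier_integral_measurable [measurable]:
  assumes [measurable]: "u \<in> borel_measurable borel"
  shows "fourier_integral u \<in> borel_measurable borel"
  unfolding fourier_integral_def by measurable

lemma norm_fourier_integral_le:
  assumes "integrable lborel u"
  shows "norm (fourier_integral u k) \<le> (\<integral>y. norm (u y) \<partial>lborel)"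
proof -
  have "norm (fourier_integral u k) \<le> (\<integral>y. norm (u y * iexp (k * y)) \<partial>lborel)"
    unfolding fourier_integral_def by (rule integral_norm_bound)
  then show ?thesis
    by (simp add: norm_mult)
qed

lemma cnj_fourier_integral: "cnj (fourier_integral u k) = fourier_integral (\<lambda>y. cnj (u y)) (- k)"
  unfolding fourier_integral_def by (subst Bochner_Integration.integral_cnj[symmetric]) (simp add: exp_cnj)

section \<open>Gaussian weights and Gaussian averages\<close>

abbreviation "gaussian \<equiv> std_normal_density"

lemma gaussian_integrable: "integrable lborel gaussian"
  by simp

text \<open>This is the characteristic function of the standard normal law at \<open>t / e\<close>,
  after substituting \<open>e * k\<close> for the variable.\<close>

lemma fourier_integral_gaussian:
  assumes e: "e > 0"
  shows "(\<integral>k. complex_of_real (exp (- (e * k)\<^sup>2 / 2)) * iexp (k * t) \<partial>lborel) = 2 * pi / e * gaussian (t / e)"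
proof -
  have "(\<integral>k. gaussian k *\<^sub>R iexp ((t / e) * k) \<partial>lborel) = char std_normal_distribution (t / e)"
    unfolding char_def by (subst integral_density) auto
  also have "\<dots> = complex_of_real (exp (- (t / e)\<^sup>2 / 2))"
    by (simp add: char_std_normal_distribution)
  also have "(\<integral>k. gaussian k *\<^sub>R iexp ((t / e) * k) \<partial>lborel)
      = e *\<^sub>R (\<integral>k. gaussian (e * k) *\<^sub>R iexp ((t / e) * (e * k)) \<partial>lborel)"
    using e by (subst lborel_integral_real_affine[where c = e and t = 0]) auto
  also have "(\<lambda>k. gaussian (e * k) *\<^sub>R iexp ((t / e) * (e * k)))
      = (\<lambda>k. (1 / sqrt (2 * pi)) *\<^sub>R (complex_of_real (exp (- (e * k)\<^sup>2 / 2)) * iexp (k * t)))"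
    using e by (auto simp: std_normal_density_def scaleR_conv_of_real mult_ac exp_of_real intro!: ext)
  finally have *: "e *\<^sub>R ((1 / sqrt (2 * pi)) *\<^sub>R (\<integral>k. complex_of_real (exp (- (e * k)\<^sup>2 / 2)) * iexp (k * t) \<partial>lborel))
      = complex_of_real (exp (- (t / e)\<^sup>2 / 2))"
    by simp
  have "complex_of_real (sqrt (2 * pi)) * complex_of_real (sqrt (2 * pi)) = 2 * pi"
    by (simp flip: of_real_mult)
  moreover have "complex_of_real (sqrt (2 * pi)) \<noteq> 0"
    by simp
  \<comment> \<open>Solving \<open>e / S * I = E\<close> gives \<open>S * E / e\<close>; writing it
    with \<open>S * S = 2 * pi\<close> leaves the factor \<open>1 / S\<close> that
    \<open>gaussian\<close> carries.\<close>
  moreover have "I = S * S / e * (E / S)" if "e *\<^sub>R ((1 / sqrt (2 * pi)) *\<^sub>R I) = E"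
      "S = complex_of_real (sqrt (2 * pi))" "S \<noteq> 0" for I E S :: complex
    using e that by (auto simp: scaleR_conv_of_real)
  ultimately show ?thesis
    using * by (simp add: std_normal_density_def)
qed

lemma integrable_exp_square:
  assumes e: "e > 0"
  shows "integrable lborel (\<lambda>k::real. exp (- (e * k)\<^sup>2 / 2))"
proof -
  have "integrable lborel (\<lambda>k. sqrt (2 * pi) * gaussian (e * k))"
    using e lborel_integrable_real_affine[OF gaussian_integrable, of e 0] by simp
  then show ?thesis
    by (simp add: std_normal_density_def)
qed

text \<open>The substitution \<open>y = x - e * s\<close> moves \<open>e\<close> from the kernel
  into the argument of \<open>v\<close>, so that the limit \<open>e \<longrightarrow> 0\<close> is
  taken against a fixed probability density.\<close>

lemma gaussian_convolution:
  fixes v :: "real \<Rightarrow> complex"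
  assumes e: "e > 0"
  shows "(\<integral>y. v y * (2 * pi / e * gaussian ((x - y) / e)) \<partial>lborel)
    = 2 * pi * (\<integral>s. v (x - e * s) * gaussian s \<partial>lborel)"
proof -
  have "(\<integral>y. v y * (2 * pi / e * gaussian ((x - y) / e)) \<partial>lborel)
     = e *\<^sub>R (\<integral>s. v (x - e * s) * (2 * pi / e * gaussian s) \<partial>lborel)"
    using e by (subst lborel_integral_real_affine[where c = "- e" and t = x]) auto
  also have "\<dots> = (\<integral>s. e *\<^sub>R (v (x - e * s) * (2 * pi / e * gaussian s)) \<partial>lborel)"
    by simp
  also have "\<dots> = (\<integral>s. 2 * pi * (v (x - e * s) * gaussian s) \<partial>lborel)"
    using e by (intro Bochner_Integration.integral_cong) (auto simp: scaleR_conv_of_real)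
  finally show ?thesis
    by simp
qed

lemma gaussian_bounded_integrable:
  fixes v :: "real \<Rightarrow> complex"
  assumes [measurable]: "v \<in> borel_measurable borel" and B: "\<And>y. norm (v y) \<le> B"
  shows "integrable lborel (\<lambda>s. v s * gaussian s)"
proof (rule Bochner_Integration.integrable_bound[of _ "\<lambda>s. B * gaussian s"])
  have "norm (v s * gaussian s) \<le> norm (B * gaussian s)" for s
  proof -
    have "norm (v s) * gaussian s \<le> \<bar>B\<bar> * gaussian s"
      using B[of s] by (intro mult_right_mono) auto
    then show ?thesis by (simp add: norm_mult abs_mult)
  qed
  then show "AE s in lborel. norm (v s * gaussian s) \<le> norm (B * gaussian s)"
    by auto
qed (use gaussian_integrable in auto)

lemma norm_gaussian_average_le:
  fixes v :: "real \<Rightarrow> complex"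
  assumes [measurable]: "v \<in> borel_measurable borel" and B: "\<And>y. norm (v y) \<le> B"
  shows "norm (\<integral>s. v s * gaussian s \<partial>lborel) \<le> B"
proof -
  have "norm (\<integral>s. v s * gaussian s \<partial>lborel) \<le> (\<integral>s. norm (v s * gaussian s) \<partial>lborel)"
    by (rule integral_norm_bound)
  also have "\<dots> \<le> (\<integral>s. B * gaussian s \<partial>lborel)"
    using integrable_norm[OF gaussian_bounded_integrable[OF assms]] B gaussian_integrable
    by (intro integral_mono) (auto simp: norm_mult intro!: mult_right_mono)
  also have "\<dots> = B"
    by simp
  finally show ?thesis .
qed

text \<open>The bound on \<open>v\<close> supplies the dominating function, so continuity enters
  only at the point \<open>x\<close>; this is what later admits functions with jumps.\<close>

lemma gaussian_approximate_identity:
  fixes v :: "real \<Rightarrow> complex"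
  assumes [measurable]: "v \<in> borel_measurable borel" and B: "\<And>y. norm (v y) \<le> B"
    and "isCont v x" and e: "e \<longlonglongrightarrow> 0"
  shows "(\<lambda>j. \<integral>s. v (x - e j * s) * gaussian s \<partial>lborel) \<longlonglongrightarrow> v x"
proof -
  have "(\<lambda>j. \<integral>s. v (x - e j * s) * gaussian s \<partial>lborel) \<longlonglongrightarrow> (\<integral>s. v x * gaussian s \<partial>lborel)"
  proof (rule integral_dominated_convergence[where w = "\<lambda>s. B * gaussian s"])
    show "AE s in lborel. (\<lambda>j. v (x - e j * s) * gaussian s) \<longlonglongrightarrow> v x * gaussian s"
    proof (rule AE_I2)
      fix s :: real
      have "(\<lambda>j. x - e j * s) \<longlonglongrightarrow> x"
        using e by (auto intro!: tendsto_eq_intros)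
      then show "(\<lambda>j. v (x - e j * s) * gaussian s) \<longlonglongrightarrow> v x * gaussian s"
        by (intro tendsto_intros isCont_tendsto_compose[OF \<open>isCont v x\<close>])
    qed
    show "AE s in lborel. norm (v (x - e j * s) * gaussian s) \<le> B * gaussian s" for j
      using B by (auto simp: norm_mult intro!: mult_right_mono)
    show "integrable lborel (\<lambda>s. B * gaussian s)"
      using gaussian_integrable by auto
  qed measurable
  then show ?thesis
    by simp
qed

text \<open>A Gaussian weight makes the double integral over \<open>u x\<close> and \<open>cnj (u y)\<close> absolutely convergent, so
  that the integral over \<open>k\<close> can be done first; the identity without weight follows by letting \<open>e \<longrightarrow> 0\<close>.\<close>

lemma gaussian_plancherel:
  assumes u: "integrable lborel u" and um [measurable]: "u \<in> borel_measurable borel" and e: "e > 0"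
  shows "(\<integral>k. exp (- (e * k)\<^sup>2 / 2) * (norm (fourier_integral u k))\<^sup>2 \<partial>lborel)
    = Re (2 * pi * (\<integral>x. u x * (\<integral>s. cnj (u (x - e * s)) * gaussian s \<partial>lborel) \<partial>lborel))"
proof -
  define W where "W k = complex_of_real (exp (- (e * k)\<^sup>2 / 2))" for k
  define A where "A = (\<integral>y. norm (u y) \<partial>lborel)"
  have Wm [measurable]: "W \<in> borel_measurable borel"
    unfolding W_def by measurable
  have W: "integrable lborel W"
    unfolding W_def using integrable_exp_square[OF e] by simp
  have cu: "integrable lborel (\<lambda>y. cnj (u y))"
    using u by simp
  have inner: "(\<integral>k. W k * (cnj (fourier_integral u k) * iexp (k * x)) \<partial>lborel)
      = 2 * pi * (\<integral>s. cnj (u (x - e * s)) * gaussian s \<partial>lborel)" for x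
  proof -
    have "(\<integral>k. W k * (cnj (fourier_integral u k) * iexp (k * x)) \<partial>lborel)
        = (\<integral>k. W k * (\<integral>y. cnj (u y) * iexp (k * (x - y)) \<partial>lborel) \<partial>lborel)"
    proof (intro Bochner_Integration.integral_cong refl arg_cong2[where f = "(*)"])
      fix k
      have "cnj (fourier_integral u k) * iexp (k * x) = (\<integral>y. cnj (u y) * iexp (- k * y) * iexp (k * x) \<partial>lborel)"
        unfolding cnj_fourier_integral unfolding fourier_integral_def by (simp only: integral_mult_left_zero of_real_minus)
      also have "\<dots> = (\<integral>y. cnj (u y) * iexp (k * (x - y)) \<partial>lborel)"
        by (intro Bochner_Integration.integral_cong) (auto simp: exp_add[symmetric] algebra_simps)
      finally show "cnj (fourier_integral u k) * iexp (k * x) = (\<integral>y. cnj (u y) * iexp (k * (x - y)) \<partial>lborel)" .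
    qed
    also have "\<dots> = (\<integral>y. cnj (u y) * (\<integral>k. W k * iexp (k * (x - y)) \<partial>lborel) \<partial>lborel)"
      by (rule lborel_pair.Fubini_bounded[OF W cu, where B = 1]) auto
    also have "\<dots> = (\<integral>y. cnj (u y) * (2 * pi / e * gaussian ((x - y) / e)) \<partial>lborel)"
      unfolding W_def by (subst fourier_integral_gaussian[OF e]) simp
    also have "\<dots> = 2 * pi * (\<integral>s. cnj (u (x - e * s)) * gaussian s \<partial>lborel)"
      by (rule gaussian_convolution[OF e])
    finally show ?thesis .
  qed
  have "complex_of_real (\<integral>k. exp (- (e * k)\<^sup>2 / 2) * (norm (fourier_integral u k))\<^sup>2 \<partial>lborel)
      = (\<integral>k. W k * (\<integral>x. u x * (cnj (fourier_integral u k) * iexp (k * x)) \<partial>lborel) \<partial>lborel)"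
  proof (subst integral_complex_of_real[symmetric], intro Bochner_Integration.integral_cong refl)
    fix k
    have "(\<integral>x. u x * (cnj (fourier_integral u k) * iexp (k * x)) \<partial>lborel) = cnj (fourier_integral u k) * fourier_integral u k"
      unfolding fourier_integral_def by (simp add: mult.left_commute[of "u _" "cnj _"] del: integral_cnj)
    then show "complex_of_real (exp (- (e * k)\<^sup>2 / 2) * (norm (fourier_integral u k))\<^sup>2)
        = W k * (\<integral>x. u x * (cnj (fourier_integral u k) * iexp (k * x)) \<partial>lborel)"
      by (simp add: W_def mult.commute complex_norm_square[of "fourier_integral u k", simplified of_real_power])
  qed
  \<comment> \<open>The conjugated transform is part of the kernel here; the L1 norm
    \<open>A\<close> of \<open>u\<close> bounds it.\<close>
  also have "\<dots> = (\<integral>x. u x * (\<integral>k. W k * (cnj (fourier_integral u k) * iexp (k * x)) \<partial>lborel) \<partial>lborel)"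
    by (rule lborel_pair.Fubini_bounded[OF W u, where B = A])
       (auto simp: norm_mult A_def norm_fourier_integral_le[OF u])
  also have "\<dots> = 2 * pi * (\<integral>x. u x * (\<integral>s. cnj (u (x - e * s)) * gaussian s \<partial>lborel) \<partial>lborel)"
    unfolding inner by (simp add: mult.left_commute[of "u _"])
  finally show ?thesis
    by (metis Re_complex_of_real)
qed

text \<open>As \<open>e\<close> decreases the weights increase to 1, so the frequency side converges
  monotonically, with no integrability known in advance. The space side converges by dominated
  convergence, since a Gaussian average of \<open>cnj (u y)\<close> is at most \<open>B\<close> in
  modulus. The nonnegative integral makes square integrability of the transform part of the
  conclusion.\<close>

lemma plancherel:
  assumes u: "integrable lborel u" and um [measurable]: "u \<in> borel_measurable borel"
    and B: "\<And>y. norm (u y) \<le> B" and C: "AE y in lborel. isCont u y"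
  shows "(\<integral>\<^sup>+k. ennreal ((norm (fourier_integral u k))\<^sup>2) \<partial>lborel) = ennreal (2 * pi * (\<integral>x. (norm (u x))\<^sup>2 \<partial>lborel))"
proof -
  define e where "e j = inverse (real (Suc j))" for j
  have e0: "e j > 0" for j
    by (simp add: e_def)
  have e: "e \<longlonglongrightarrow> 0"
    unfolding e_def by (rule LIMSEQ_inverse_real_of_nat)
  have e_anti: "e j \<le> e i" if "i \<le> j" for i j
    using that by (simp add: e_def field_simps)
  define w where "w j k = exp (- (e j * k)\<^sup>2 / 2) * (norm (fourier_integral u k))\<^sup>2" for j k
  define A where "A = (\<integral>y. norm (u y) \<partial>lborel)"
  have [measurable]: "w j \<in> borel_measurable borel" for j
    unfolding w_def by measurable
  have w0: "0 \<le> w j k" for j k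
    by (simp add: w_def)
  have w_mono: "w i k \<le> w j k" if "i \<le> j" for i j k
  proof -
    have "\<bar>e j * k\<bar> \<le> \<bar>e i * k\<bar>"
      using e_anti[OF that] e0[of i] e0[of j] by (simp add: abs_mult mult_right_mono)
    then have "(e j * k)\<^sup>2 \<le> (e i * k)\<^sup>2"
      by (simp only: abs_le_square_iff)
    then show ?thesis
      unfolding w_def by (intro mult_right_mono) auto
  qed
  have int: "integrable lborel (w j)" for j
  proof (rule Bochner_Integration.integrable_bound)
    show "integrable lborel (\<lambda>k. A\<^sup>2 * exp (- (e j * k)\<^sup>2 / 2))"
      using integrable_exp_square[OF e0[of j]] by simp
    show "AE k in lborel. norm (w j k) \<le> norm (A\<^sup>2 * exp (- (e j * k)\<^sup>2 / 2))"
      using norm_fourier_integral_le[OF u]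
      by (auto simp: w_def A_def mult.commute intro!: mult_right_mono power_mono)
  qed measurable
  have "(\<lambda>j. \<integral>x. u x * (\<integral>s. cnj (u (x - e j * s)) * gaussian s \<partial>lborel) \<partial>lborel)
      \<longlonglongrightarrow> (\<integral>x. u x * cnj (u x) \<partial>lborel)"
  proof (rule integral_dominated_convergence[where w = "\<lambda>x. norm (u x) * B"])
    show "AE x in lborel. (\<lambda>j. u x * (\<integral>s. cnj (u (x - e j * s)) * gaussian s \<partial>lborel))
        \<longlonglongrightarrow> u x * cnj (u x)"
      using C
    proof eventually_elim
      case (elim x)
      then have "isCont (\<lambda>y. cnj (u y)) x"
        by (simp add: continuous_cnj)
      from gaussian_approximate_identity[OF _ _ this e, of B] show ?case
        using B by (intro tendsto_intros) (simp_all, measurable)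
    qed
    show "AE x in lborel. norm (u x * (\<integral>s. cnj (u (x - e j * s)) * gaussian s \<partial>lborel)) \<le> norm (u x) * B" for j
      unfolding norm_mult
      by (intro AE_I2 mult_left_mono norm_gaussian_average_le) (use B in auto)
  qed (use u in auto)
  from tendsto_Re[OF tendsto_mult[OF tendsto_const this, of "2 * pi"]]
  have "(\<lambda>j. \<integral>k. w j k \<partial>lborel) \<longlonglongrightarrow> Re (2 * pi * (\<integral>x. u x * cnj (u x) \<partial>lborel))"
    unfolding w_def gaussian_plancherel[OF u um e0] by simp
  also have "(\<integral>x. u x * cnj (u x) \<partial>lborel) = complex_of_real (\<integral>x. (norm (u x))\<^sup>2 \<partial>lborel)"
    by (subst integral_complex_of_real[symmetric]) (simp only: complex_norm_square)
  finally have lim1: "(\<lambda>j. \<integral>\<^sup>+k. ennreal (w j k) \<partial>lborel)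
      \<longlonglongrightarrow> ennreal (2 * pi * (\<integral>x. (norm (u x))\<^sup>2 \<partial>lborel))"
    using int w0 by (subst nn_integral_eq_integral) (auto intro!: tendsto_ennrealI)
  have "(\<integral>\<^sup>+k. (SUP j. ennreal (w j k)) \<partial>lborel) = (SUP j. \<integral>\<^sup>+k. ennreal (w j k) \<partial>lborel)"
  proof (rule nn_integral_monotone_convergence_SUP)
    show "incseq (\<lambda>j k. ennreal (w j k))"
      using w_mono by (auto simp: incseq_def le_fun_def intro!: ennreal_leI)
  qed measurable
  moreover have "incseq (\<lambda>j. \<integral>\<^sup>+k. ennreal (w j k) \<partial>lborel)"
    using w_mono by (auto simp: incseq_def intro!: nn_integral_mono ennreal_leI)
  then have "(\<lambda>j. \<integral>\<^sup>+k. ennreal (w j k) \<partial>lborel) \<longlonglongrightarrow> (SUP j. \<integral>\<^sup>+k. ennreal (w j k) \<partial>lborel)"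
    by (rule LIMSEQ_SUP)
  moreover have "(SUP j. ennreal (w j k)) = ennreal ((norm (fourier_integral u k))\<^sup>2)" for k
  proof (rule LIMSEQ_unique)
    have "incseq (\<lambda>j. ennreal (w j k))"
      using w_mono by (auto simp: incseq_def intro!: ennreal_leI)
    then show "(\<lambda>j. ennreal (w j k)) \<longlonglongrightarrow> (SUP j. ennreal (w j k))"
      by (rule LIMSEQ_SUP)
    have "(\<lambda>j. w j k) \<longlonglongrightarrow> exp (- (0 * k)\<^sup>2 / 2) * (norm (fourier_integral u k))\<^sup>2"
      unfolding w_def by (intro tendsto_intros e) auto
    then show "(\<lambda>j. ennreal (w j k)) \<longlonglongrightarrow> ennreal ((norm (fourier_integral u k))\<^sup>2)"
      by (simp add: tendsto_ennrealI)
  qed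
  ultimately show ?thesis
    using LIMSEQ_unique[OF lim1] by simp
qed

section \<open>Fourier pairs and the transform in the mean\<close>

lemma fourier_integral_cnj_reflect:
  "cnj (fourier_integral u x) = fourier_integral (\<lambda>k. cnj (u (- k))) x"
proof -
  have "fourier_integral (\<lambda>k. cnj (u (- k))) x = \<bar>- 1\<bar> *\<^sub>R (\<integral>y. cnj (u (- (0 + - 1 * y))) * iexp (x * (0 + - 1 * y)) \<partial>lborel)"
    unfolding fourier_integral_def by (rule lborel_integral_real_affine) simp
  then show ?thesis
    unfolding cnj_fourier_integral unfolding fourier_integral_def by simp
qed

lemma AE_lborel_nonzero: "AE k::real in lborel. k \<noteq> 0"
  by (rule AE_I[of _ _ "{0}"]) auto

text \<open>The regularity required of \<open>u\<close> is what Plancherel's identity needs for both \<open>u\<close> and \<open>k u k\<close>. A jump at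
  \<open>0\<close> must be allowed: the transforms of rational functions with poles in one half plane have one.\<close>

definition fourier_pair :: "(real \<Rightarrow> complex) \<Rightarrow> (real \<Rightarrow> complex) \<Rightarrow> bool" where
  "fourier_pair u h \<longleftrightarrow>
     integrable lborel u \<and> integrable lborel (\<lambda>k. of_real k * u k) \<and>
     (\<exists>B. \<forall>k. norm (u k) \<le> B \<and> norm (of_real k * u k) \<le> B) \<and> (\<forall>k. k \<noteq> 0 \<longrightarrow> isCont u k) \<and>
     (\<forall>x. h x = fourier_integral u x) \<and>
     (\<forall>x. (h has_vector_derivative fourier_integral (\<lambda>k. \<i> * of_real k * u k) x) (at x))"

lemma fourier_pairD:
  assumes "fourier_pair u h"
  shows "integrable lborel u" "integrable lborel (\<lambda>k. of_real k * u k)"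
    "k \<noteq> 0 \<Longrightarrow> isCont u k" "h = fourier_integral u"
    "(h has_vector_derivative fourier_integral (\<lambda>k. \<i> * of_real k * u k) x) (at x)"
    "u \<in> borel_measurable borel"
  using assms borel_measurable_integrable[of lborel u] unfolding fourier_pair_def by auto

lemma fourier_pair_bound:
  assumes "fourier_pair u h"
  obtains B where "\<And>k. norm (u k) \<le> B" "\<And>k. norm (of_real k * u k) \<le> B"
  using assms unfolding fourier_pair_def by blast

lemma fourier_integral_add:
  assumes "integrable lborel u" "integrable lborel v"
  shows "fourier_integral (\<lambda>k. u k + v k) x = fourier_integral u x + fourier_integral v x"
  unfolding fourier_integral_def using integrable_iexp_mult[OF assms(1)] integrable_iexp_mult[OF assms(2)]
  by (simp add: distrib_right)

lemma fourier_integral_mult: "fourier_integral (\<lambda>k. c * u k) x = c * fourier_integral u x"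
  unfolding fourier_integral_def by (simp add: mult.assoc)

lemma fourier_pair_add:
  assumes u: "fourier_pair u h" and v: "fourier_pair v h'"
  shows "fourier_pair (\<lambda>k. u k + v k) (\<lambda>x. h x + h' x)"
proof -
  obtain B where B: "\<And>k. norm (u k) \<le> B" "\<And>k. norm (of_real k * u k) \<le> B"
    using fourier_pair_bound[OF u] by blast
  obtain C where C: "\<And>k. norm (v k) \<le> C" "\<And>k. norm (of_real k * v k) \<le> C"
    using fourier_pair_bound[OF v] by blast
  note D = fourier_pairD[OF u] fourier_pairD[OF v]
  have i: "integrable lborel (\<lambda>k. \<i> * of_real k * u k)" "integrable lborel (\<lambda>k. \<i> * of_real k * v k)"
    using D(2,8) by (simp_all add: mult.assoc)
  have "norm (u k + v k) \<le> B + C" "norm (of_real k * (u k + v k)) \<le> B + C" for k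
    using norm_triangle_mono[OF B(1) C(1)] norm_triangle_mono[OF B(2) C(2)]
    by (simp_all add: distrib_left)
  moreover have "((\<lambda>x. h x + h' x) has_vector_derivative fourier_integral (\<lambda>k. \<i> * of_real k * (u k + v k)) x) (at x)" for x
    using has_vector_derivative_add[OF D(5) D(11), of x] by (simp add: fourier_integral_add[OF i, symmetric] distrib_left)
  ultimately show ?thesis
    unfolding fourier_pair_def using D fourier_integral_add[OF D(1) D(7)]
    by (auto simp: distrib_left intro!: continuous_intros)
qed

lemma fourier_pair_mult:
  assumes u: "fourier_pair u h"
  shows "fourier_pair (\<lambda>k. c * u k) (\<lambda>x. c * h x)"
proof -
  obtain B where B: "\<And>k. norm (u k) \<le> B" "\<And>k. norm (of_real k * u k) \<le> B"
    using fourier_pair_bound[OF u] by blast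
  note D = fourier_pairD[OF u]
  have "norm (c * u k) \<le> norm c * B" "norm (of_real k * (c * u k)) \<le> norm c * B" for k
    using mult_left_mono[OF B(1), of "norm c" k] mult_left_mono[OF B(2), of "norm c" k]
    by (simp_all add: norm_mult mult_ac)
  moreover have "((\<lambda>x. c * h x) has_vector_derivative fourier_integral (\<lambda>k. \<i> * of_real k * (c * u k)) x) (at x)" for x
    using has_vector_derivative_mult_right[OF D(5), of c x] by (simp add: fourier_integral_mult[symmetric] mult_ac)
  moreover have "(\<lambda>k. of_real k * (c * u k)) = (\<lambda>k. c * (of_real k * u k))"
    by (simp add: mult_ac)
  ultimately show ?thesis
    unfolding fourier_pair_def using D by (auto simp: fourier_integral_mult intro!: continuous_intros)
qed

lemma fourier_pair_zero: "fourier_pair (\<lambda>_. 0) (\<lambda>_. 0)"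
  unfolding fourier_pair_def by (auto simp: fourier_integral_def)

text \<open>The amplitude stays existential: later estimates use only \<open>h\<close>, its
  derivative and the two Plancherel identities.\<close>

lemma fourier_pair_sum:
  assumes "finite A" "\<And>i. i \<in> A \<Longrightarrow> \<exists>u. fourier_pair u (h i)"
  shows "\<exists>u. fourier_pair u (\<lambda>x. \<Sum>i\<in>A. h i x)"
  using assms
proof (induction A rule: finite_induct)
  case empty
  then show ?case using fourier_pair_zero by auto
next
  case (insert i A)
  then obtain u v where "fourier_pair u (h i)" "fourier_pair v (\<lambda>x. \<Sum>i\<in>A. h i x)"
    by (metis insertCI)
  from fourier_pair_add[OF this] insert show ?case by auto
qed

text \<open>Conjugation reflects the amplitude to the other half line. It carries positive powers of
  the Moebius map to negative ones.\<close>

lemma fourier_pair_cnj: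
  assumes u: "fourier_pair u h"
  shows "fourier_pair (\<lambda>k. cnj (u (- k))) (\<lambda>x. cnj (h x))"
proof -
  obtain B where B: "\<And>k. norm (u k) \<le> B" "\<And>k. norm (of_real k * u k) \<le> B"
    using fourier_pair_bound[OF u] by blast
  note D = fourier_pairD[OF u]
  have c: "isCont (\<lambda>k. cnj (u (- k))) k" if "k \<noteq> 0" for k
    using that by (intro continuous_cnj isCont_o2[where g = u and f = uminus] D(3)) auto
  have B': "norm (of_real k * cnj (u (- k))) \<le> B" for k
    using B(2)[of "- k"] by (simp add: norm_mult)
  have r: "integrable lborel (\<lambda>k. cnj (v (- k)))" if "integrable lborel v" for v :: "real \<Rightarrow> complex"
    using lborel_integrable_real_affine[OF that, of "- 1" 0] by simp
  have "((\<lambda>x. cnj (h x)) has_vector_derivative fourier_integral (\<lambda>k. \<i> * of_real k * cnj (u (- k))) x) (at x)" for x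
    using has_vector_derivative_cnj[OF D(5), of x] by (simp add: fourier_integral_cnj_reflect)
  then show ?thesis
    unfolding fourier_pair_def using D(4) B(1) B' c r[OF D(1)] r[OF D(2)]
    by (auto simp: fourier_integral_cnj_reflect intro!: exI[of _ B])
qed

lemma plancherel_integrable:
  assumes u: "integrable lborel u" and um [measurable]: "u \<in> borel_measurable borel"
    and B: "\<And>y. norm (u y) \<le> B" and C: "AE y in lborel. isCont u y"
  shows "integrable lborel (\<lambda>x. (norm (u x))\<^sup>2)"
    and "integrable lborel (\<lambda>k. (norm (fourier_integral u k))\<^sup>2)"
    and "(\<integral>k. (norm (fourier_integral u k))\<^sup>2 \<partial>lborel) = 2 * pi * (\<integral>x. (norm (u x))\<^sup>2 \<partial>lborel)"
proof -
  have "norm (u x) * norm (u x) \<le> \<bar>B\<bar> * norm (u x)" for x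
    using B[of x] by (intro mult_right_mono) auto
  then show "integrable lborel (\<lambda>x. (norm (u x))\<^sup>2)"
    using u by (intro Bochner_Integration.integrable_bound[of _ "\<lambda>x. B * norm (u x)" "\<lambda>x. (norm (u x))\<^sup>2"])
      (auto simp: power2_eq_square abs_mult)
  have P: "has_bochner_integral lborel (\<lambda>k. (norm (fourier_integral u k))\<^sup>2) (2 * pi * (\<integral>x. (norm (u x))\<^sup>2 \<partial>lborel))"
    by (rule has_bochner_integral_nn_integral) (use plancherel[OF assms] in auto)
  show "integrable lborel (\<lambda>k. (norm (fourier_integral u k))\<^sup>2)"
    using P by (rule integrable.intros)
  show "(\<integral>k. (norm (fourier_integral u k))\<^sup>2 \<partial>lborel) = 2 * pi * (\<integral>x. (norm (u x))\<^sup>2 \<partial>lborel)"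
    using P by (rule has_bochner_integral_integral_eq)
qed

section \<open>Limits in the mean of truncated transforms\<close>

lemma fourier_trunc_eq_fourier_integral:
  "fourier_trunc f r k = fourier_integral (\<lambda>x. indicator {-r..r} x *\<^sub>R f x) (- k)"
  unfolding fourier_trunc_def fourier_integral_def set_lebesgue_integral_def
  by (intro Bochner_Integration.integral_cong) (auto simp: scaleR_conv_of_real mult_ac)

lemma fourier_trunc_measurable:
  assumes [measurable]: "f \<in> borel_measurable borel"
  shows "fourier_trunc f r \<in> borel_measurable borel"
proof -
  have "fourier_trunc f r = (\<lambda>k. fourier_integral (\<lambda>x. indicator {-r..r} x *\<^sub>R f x) (- k))"
    by (simp add: fourier_trunc_eq_fourier_integral fun_eq_iff)
  also have "\<dots> \<in> borel_measurable borel"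
    by measurable
  finally show ?thesis .
qed

text \<open>\<open>fourier_L2\<close> is a choice among all limits in the mean; uniqueness up to
  null sets lets \<open>H1_norm\<close> be evaluated with any convenient version. The inequality |a
  - b|^2 \<le> 2 |t - a|^2 + 2 |t - b|^2 stays with the nonnegative integrals of squares from the
  definition.\<close>

lemma is_fourier_L2_unique:
  assumes [measurable]: "f \<in> borel_measurable borel" and "is_fourier_L2 f g" "is_fourier_L2 f g'"
  shows "AE k in lborel. g k = g' k"
proof -
  have [measurable]: "g \<in> borel_measurable borel" "g' \<in> borel_measurable borel"
    using assms by (auto simp: is_fourier_L2_def L2_space_def)
  have [measurable]: "fourier_trunc f r \<in> borel_measurable borel" for r
    by (rule fourier_trunc_measurable) fact
  define D where "D g r = (\<integral>\<^sup>+ k. ennreal ((norm (fourier_trunc f r k - g k))\<^sup>2) \<partial>lborel)" for g r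
  have lim: "((\<lambda>r. 2 * D g r + 2 * D g' r) \<longlongrightarrow> 2 * 0 + 2 * 0) at_top"
    using assms unfolding D_def is_fourier_L2_def
    by (intro tendsto_add ennreal_tendsto_cmult) auto
  have "(\<integral>\<^sup>+ k. ennreal ((norm (g k - g' k))\<^sup>2) \<partial>lborel) \<le> 2 * D g r + 2 * D g' r" for r
  proof -
    have "(norm (a - b))\<^sup>2 \<le> 2 * (norm (t - a))\<^sup>2 + 2 * (norm (t - b))\<^sup>2" for a b t :: complex
    proof -
      have "norm (a - b) \<le> norm (t - a) + norm (t - b)"
        by (metis norm_minus_commute norm_triangle_sub dist_norm dist_triangle2 dist_commute)
      then have "(norm (a - b))\<^sup>2 \<le> (norm (t - a) + norm (t - b))\<^sup>2"
        by (intro power_mono) auto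
      also have "\<dots> \<le> 2 * (norm (t - a))\<^sup>2 + 2 * (norm (t - b))\<^sup>2"
        using sum_squares_bound[of "norm (t - a)" "norm (t - b)"] by (simp add: power2_sum)
      finally show ?thesis .
    qed
    then have "(\<integral>\<^sup>+ k. ennreal ((norm (g k - g' k))\<^sup>2) \<partial>lborel)
        \<le> (\<integral>\<^sup>+ k. 2 * ennreal ((norm (fourier_trunc f r k - g k))\<^sup>2)
            + 2 * ennreal ((norm (fourier_trunc f r k - g' k))\<^sup>2) \<partial>lborel)"
      by (intro nn_integral_mono) (simp add: ennreal_plus[symmetric] ennreal_mult'[symmetric] ennreal_leI
          flip: ennreal_numeral del: ennreal_plus)
    also have "\<dots> = 2 * D g r + 2 * D g' r"
      unfolding D_def by (simp add: nn_integral_add nn_integral_cmult)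
    finally show ?thesis .
  qed
  then have "(\<integral>\<^sup>+ k. ennreal ((norm (g k - g' k))\<^sup>2) \<partial>lborel) \<le> 2 * 0 + 2 * 0"
    by (intro tendsto_lowerbound[OF lim] always_eventually allI) auto
  then have "(\<integral>\<^sup>+ k. ennreal ((norm (g k - g' k))\<^sup>2) \<partial>lborel) = 0"
    by simp
  then have "AE k in lborel. ennreal ((norm (g k - g' k))\<^sup>2) = 0"
    by (subst (asm) nn_integral_0_iff_AE) auto
  then show ?thesis
    by eventually_elim (simp add: ennreal_eq_0_iff)
qed

lemma fourier_L2_AE_eq:
  assumes "f \<in> borel_measurable borel" "is_fourier_L2 f g"
  shows "is_fourier_L2 f (fourier_L2 f)" "AE k in lborel. fourier_L2 f k = g k"
proof -
  show *: "is_fourier_L2 f (fourier_L2 f)"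
    unfolding fourier_L2_def by (rule someI[of "is_fourier_L2 f", OF assms(2)])
  show "AE k in lborel. fourier_L2 f k = g k"
    by (rule is_fourier_L2_unique[OF assms(1) * assms(2)])
qed

lemma fourier_pair_measurable:
  assumes "fourier_pair u h"
  shows "u \<in> borel_measurable borel" "h \<in> borel_measurable borel" "continuous_on UNIV h"
proof -
  show "u \<in> borel_measurable borel"
    by (rule fourier_pairD(6)[OF assms])
  show *: "continuous_on UNIV h"
    using fourier_pairD(5)[OF assms]
    by (intro continuous_at_imp_continuous_on ballI) (blast intro: has_vector_derivative_continuous)
  show "h \<in> borel_measurable borel"
    by (rule borel_measurable_continuous_onI[OF *])
qed

lemma fourier_pair_plancherel:
  assumes P: "fourier_pair u h"
  shows "integrable lborel (\<lambda>k. (norm (u k))\<^sup>2)" "integrable lborel (\<lambda>x. (norm (h x))\<^sup>2)"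
    "(\<integral>x. (norm (h x))\<^sup>2 \<partial>lborel) = 2 * pi * (\<integral>k. (norm (u k))\<^sup>2 \<partial>lborel)"
proof -
  obtain B where B: "\<And>k. norm (u k) \<le> B"
    by (rule fourier_pair_bound[OF P]) blast
  have C: "AE k in lborel. isCont u k"
    using AE_lborel_nonzero by eventually_elim (use fourier_pairD(3)[OF P] in blast)
  note Q = plancherel_integrable[OF fourier_pairD(1)[OF P] fourier_pairD(6)[OF P] B C]
  show "integrable lborel (\<lambda>k. (norm (u k))\<^sup>2)" "integrable lborel (\<lambda>x. (norm (h x))\<^sup>2)"
    "(\<integral>x. (norm (h x))\<^sup>2 \<partial>lborel) = 2 * pi * (\<integral>k. (norm (u k))\<^sup>2 \<partial>lborel)"
    using Q unfolding fourier_pairD(4)[OF P] by auto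
qed

text \<open>Uniqueness of the derivative identifies \<open>h'\<close> with the transform of
  \<open>\<i> * of_real k * u k\<close>, to which Plancherel applies in turn.\<close>

lemma fourier_pair_plancherel_deriv:
  assumes P: "fourier_pair u h" and d: "\<And>x. (h has_vector_derivative h' x) (at x)"
  shows "integrable lborel (\<lambda>k. k\<^sup>2 * (norm (u k))\<^sup>2)"
    "(\<integral>x. (norm (h' x))\<^sup>2 \<partial>lborel) = 2 * pi * (\<integral>k. k\<^sup>2 * (norm (u k))\<^sup>2 \<partial>lborel)"
proof -
  obtain B where B: "\<And>k. norm (\<i> * of_real k * u k) \<le> B"
    using fourier_pair_bound[OF P] by (metis mult.assoc norm_mult norm_ii mult_1)
  have C: "AE k in lborel. isCont (\<lambda>k. \<i> * of_real k * u k) k"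
    using AE_lborel_nonzero by eventually_elim (intro continuous_intros fourier_pairD(3)[OF P])
  have i: "integrable lborel (\<lambda>k. \<i> * of_real k * u k)"
    using fourier_pairD(2)[OF P] by (simp add: mult.assoc)
  have m: "(\<lambda>k. \<i> * of_real k * u k) \<in> borel_measurable borel"
    using fourier_pairD(6)[OF P] by measurable
  have h': "h' = fourier_integral (\<lambda>k. \<i> * of_real k * u k)"
    using vector_derivative_unique_at[OF d fourier_pairD(5)[OF P]] by auto
  show "integrable lborel (\<lambda>k. k\<^sup>2 * (norm (u k))\<^sup>2)"
    "(\<integral>x. (norm (h' x))\<^sup>2 \<partial>lborel) = 2 * pi * (\<integral>k. k\<^sup>2 * (norm (u k))\<^sup>2 \<partial>lborel)"
    using plancherel_integrable[OF i m B C] unfolding h' by (auto simp: norm_mult power_mult_distrib)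
qed

text \<open>With \<open>F\<close> the transform of the truncation of \<open>h\<close> and \<open>G = 2 pi u\<close>, both \<open>\<parallel>F\<parallel>\<^sup>2\<close> and \<open>\<langle>F, G\<rangle>\<close> equal \<open>2 pi\<close> times
  the truncated energy of \<open>h\<close>, and \<open>\<parallel>G\<parallel>\<^sup>2\<close> is \<open>2 pi\<close> times the full energy.\<close>

lemma fourier_pair_is_fourier_L2:
  assumes P: "fourier_pair u h"
  shows "is_fourier_L2 h (\<lambda>k. complex_of_real (2 * pi) * u k)"
proof -
  note [measurable] = fourier_pair_measurable(1,2)[OF P]
  note h = fourier_pairD(4)[OF P] and u = fourier_pairD(1)[OF P]
  define G where "G k = complex_of_real (2 * pi) * u k" for k
  define N where "N = (\<integral>x. (norm (h x))\<^sup>2 \<partial>lborel)"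
  define hr where "hr r x = indicator {-r..r} x *\<^sub>R h x" for r x
  define Nr where "Nr r = (\<integral>x. (norm (hr r x))\<^sup>2 \<partial>lborel)" for r
  define A where "A = (\<integral>y. norm (u y) \<partial>lborel)"
  have [measurable]: "hr r \<in> borel_measurable borel" for r
    unfolding hr_def by measurable
  have G: "integrable lborel G" "integrable lborel (\<lambda>k. (norm (G k))\<^sup>2)"
    "(\<integral>k. (norm (G k))\<^sup>2 \<partial>lborel) = 2 * pi * N"
  proof -
    have *: "(\<lambda>k. (norm (G k))\<^sup>2) = (\<lambda>k. 4 * pi\<^sup>2 * (norm (u k))\<^sup>2)"
      by (simp add: G_def norm_mult power_mult_distrib)
    show "integrable lborel G"
      unfolding G_def using u by simp
    show "integrable lborel (\<lambda>k. (norm (G k))\<^sup>2)" "(\<integral>k. (norm (G k))\<^sup>2 \<partial>lborel) = 2 * pi * N"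
      unfolding * N_def using fourier_pair_plancherel[OF P] by (simp_all add: power2_eq_square)
  qed
  have [measurable]: "G \<in> borel_measurable borel"
    unfolding G_def by measurable
  have hA: "norm (h x) \<le> A" for x
    unfolding h A_def by (rule norm_fourier_integral_le[OF u])
  have A0: "A \<ge> 0"
    using hA norm_ge_zero order_trans by blast
  have hr_int: "integrable lborel (hr r)" for r
  proof (rule Bochner_Integration.integrable_bound)
    show "integrable lborel (\<lambda>x. indicator {-r..r} x *\<^sub>R A)"
      by (intro integrable_scaleR_left) (auto intro!: integrable_real_indicator simp: emeasure_lborel_Icc_eq)
  qed (use hA A0 in \<open>auto simp: hr_def indicator_def\<close>)
  have key: "(\<integral>\<^sup>+ k. ennreal ((norm (fourier_trunc h r k - G k))\<^sup>2) \<partial>lborel) = ennreal (2 * pi * (N - Nr r))" for r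
  proof -
    define F where "F k = fourier_integral (hr r) (- k)" for k
    have [measurable]: "F \<in> borel_measurable borel"
      unfolding F_def by measurable
    have hrA: "norm (hr r x) \<le> A" for x
      using hA A0 by (auto simp: hr_def indicator_def)
    \<comment> \<open>Truncation creates jumps only at \<open>- r\<close> and \<open>r\<close>, a
      null set, so Plancherel still applies to \<open>hr r\<close>.\<close>
    have C: "AE x in lborel. isCont (hr r) x"
    proof (rule AE_I[of _ _ "{-r, r}"])
      show "{x \<in> space lborel. \<not> isCont (hr r) x} \<subseteq> {-r, r}"
      proof (rule subsetI, rule ccontr)
        fix x assume x: "x \<in> {x \<in> space lborel. \<not> isCont (hr r) x}" "x \<notin> {-r, r}"
        have hc: "isCont h x"
          using fourier_pair_measurable(3)[OF P] by (simp add: continuous_on_eq_continuous_at)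
        have "isCont (hr r) x"
          unfolding hr_def
        proof (intro continuous_scaleR hc)
          show "isCont (indicator {-r..r} :: real \<Rightarrow> real) x"
            using x(2) by (subst isCont_indicator) (auto simp: frontier_def interior_atLeastAtMost_real)
        qed
        then show False using x by auto
      qed
    qed (auto intro!: emeasure_lborel_countable)
    note Q = plancherel_integrable[OF hr_int _ hrA C, simplified]
    have F: "integrable lborel (\<lambda>k. (norm (F k))\<^sup>2)"
      unfolding F_def using lborel_integrable_real_affine[OF Q(2), of "- 1" 0] by simp
    have FN: "(\<integral>k. (norm (F k))\<^sup>2 \<partial>lborel) = 2 * pi * Nr r"
      unfolding F_def Nr_def using lborel_integral_real_affine[of "- 1" "\<lambda>k. (norm (fourier_integral (hr r) k))\<^sup>2" 0] Q(3)
      by simp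
    have F_bd: "norm (F k) \<le> (\<integral>y. norm (hr r y) \<partial>lborel)" for k
      unfolding F_def by (rule norm_fourier_integral_le[OF hr_int])
    have cG: "integrable lborel (\<lambda>k. cnj (G k))"
      using G(1) by simp
    have GF: "integrable lborel (\<lambda>k. cnj (G k) * F k)"
    proof (rule Bochner_Integration.integrable_bound[of _ "\<lambda>k. (\<integral>y. norm (hr r y) \<partial>lborel) *\<^sub>R norm (G k)"])
      show "AE k in lborel. norm (cnj (G k) * F k) \<le> norm ((\<integral>y. norm (hr r y) \<partial>lborel) *\<^sub>R norm (G k))"
        using F_bd by (auto simp: norm_mult abs_mult mult.commute[of "norm (G _)"] intro!: mult_right_mono
            order_trans[OF F_bd abs_ge_self])
    qed (use G(1) in auto)
    have "(\<integral>k. cnj (G k) * F k \<partial>lborel)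
        = (\<integral>k. cnj (G k) * (\<integral>x. hr r x * iexp (- k * x) \<partial>lborel) \<partial>lborel)"
      unfolding F_def fourier_integral_def ..
    also have "\<dots> = (\<integral>x. hr r x * (\<integral>k. cnj (G k) * iexp (- k * x) \<partial>lborel) \<partial>lborel)"
      by (rule lborel_pair.Fubini_bounded[OF cG hr_int, where B = 1]) auto
    also have "\<dots> = (\<integral>x. 2 * pi * complex_of_real ((norm (hr r x))\<^sup>2) \<partial>lborel)"
    proof (intro Bochner_Integration.integral_cong refl)
      fix x
      have "(\<integral>k. cnj (G k) * iexp (- k * x) \<partial>lborel) = fourier_integral (\<lambda>k. cnj (G k)) (- x)"
        unfolding fourier_integral_def by (simp add: mult.commute)
      also have "\<dots> = cnj (fourier_integral G x)"
        by (simp add: cnj_fourier_integral)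
      also have "fourier_integral G x = complex_of_real (2 * pi) * h x"
        unfolding G_def h by (rule fourier_integral_mult)
      finally have *: "(\<integral>k. cnj (G k) * iexp (- k * x) \<partial>lborel) = 2 * pi * cnj (h x)"
        by simp
      show "hr r x * (\<integral>k. cnj (G k) * iexp (- k * x) \<partial>lborel) = 2 * pi * complex_of_real ((norm (hr r x))\<^sup>2)"
        unfolding * complex_norm_square by (simp add: hr_def indicator_def)
    qed
    also have "\<dots> = complex_of_real (2 * pi * Nr r)"
      unfolding Nr_def by (simp only: integral_mult_right_zero integral_complex_of_real) simp
    finally have GFN: "(\<integral>k. cnj (G k) * F k \<partial>lborel) = complex_of_real (2 * pi * Nr r)" .
    have pt: "(norm (F k - G k))\<^sup>2 = (norm (F k))\<^sup>2 - 2 * Re (cnj (G k) * F k) + (norm (G k))\<^sup>2" for k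
      by (simp add: cmod_power2) (simp add: power2_eq_square algebra_simps)
    have int: "integrable lborel (\<lambda>k. (norm (F k - G k))\<^sup>2)"
      unfolding pt using F GF G(2) by (intro Bochner_Integration.integrable_add Bochner_Integration.integrable_diff
          integrable_mult_right integrable_Re)
    have "(\<integral>k. (norm (F k - G k))\<^sup>2 \<partial>lborel) = 2 * pi * Nr r - 2 * Re (complex_of_real (2 * pi * Nr r)) + 2 * pi * N"
    proof -
      have "(\<integral>k. Re (cnj (G k) * F k) \<partial>lborel) = Re (complex_of_real (2 * pi * Nr r))"
        unfolding GFN[symmetric] by (rule integral_Re[OF GF])
      then show ?thesis
        unfolding pt FN[symmetric] G(3)[symmetric] using F G(2) integrable_Re[OF GF]
        by (simp del: complex_cnj times_complex.sel)
    qed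
    then have "(\<integral>k. (norm (F k - G k))\<^sup>2 \<partial>lborel) = 2 * pi * (N - Nr r)"
      by (simp add: algebra_simps)
    moreover have "fourier_trunc h r k = F k" for k
      unfolding F_def hr_def by (rule fourier_trunc_eq_fourier_integral)
    ultimately show ?thesis
      using int by (simp add: nn_integral_eq_integral)
  qed
  have "(Nr \<longlongrightarrow> N) at_top"
    unfolding Nr_def N_def
  proof (rule integral_dominated_convergence_at_top[where w = "\<lambda>x. (norm (h x))\<^sup>2"])
    show "AE x in lborel. ((\<lambda>r. (norm (hr r x))\<^sup>2) \<longlongrightarrow> (norm (h x))\<^sup>2) at_top"
    proof (rule AE_I2, rule tendsto_eventually)
      fix x :: real
      show "\<forall>\<^sub>F r in at_top. (norm (hr r x))\<^sup>2 = (norm (h x))\<^sup>2"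
        using eventually_ge_at_top[of "\<bar>x\<bar>"]
        by eventually_elim (auto simp: hr_def indicator_def)
    qed
    show "\<forall>\<^sub>F r in at_top. AE x in lborel. norm ((norm (hr r x))\<^sup>2) \<le> (norm (h x))\<^sup>2"
      by (auto simp: hr_def indicator_def)
    show "integrable lborel (\<lambda>x. (norm (h x))\<^sup>2)"
      by (rule fourier_pair_plancherel(2)[OF P])
  qed measurable
  then have "((\<lambda>r. ennreal (2 * pi * (N - Nr r))) \<longlongrightarrow> ennreal (2 * pi * (N - N))) at_top"
    by (intro tendsto_ennrealI tendsto_intros)
  then show ?thesis
    unfolding is_fourier_L2_def key[unfolded G_def] L2_space_def using G(2) unfolding G_def by simp
qed

text \<open>The inequality (1 + |k|)^2 \<le> 2 (1 + k^2) separates the contributions of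
  \<open>h\<close> and \<open>h'\<close>. In the constant 4 pi, the transform
  \<open>2 * pi * u\<close> contributes 4 pi^2, this inequality 2, and Plancherel divides by 2
  pi.\<close>

lemma fourier_pair_H1:
  assumes P: "fourier_pair u h" and d: "\<And>x. (h has_vector_derivative h' x) (at x)"
  shows "h \<in> H1_space"
    and "H1_norm h \<le> sqrt (4 * pi * ((\<integral>x. (norm (h x))\<^sup>2 \<partial>lborel) + (\<integral>x. (norm (h' x))\<^sup>2 \<partial>lborel)))"
proof -
  note [measurable] = fourier_pair_measurable(1,2)[OF P]
  note F = fourier_pair_is_fourier_L2[OF P]
  note Q = fourier_pair_plancherel[OF P] fourier_pair_plancherel_deriv[OF P d]
  let ?w = "\<lambda>k. (1 + \<bar>k\<bar>)\<^sup>2 * (norm (complex_of_real (2 * pi) * u k))\<^sup>2"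
  let ?b = "\<lambda>k. 8 * pi\<^sup>2 * ((norm (u k))\<^sup>2 + k\<^sup>2 * (norm (u k))\<^sup>2)"
  have le: "?w k \<le> ?b k" for k
  proof -
    have "(1 + \<bar>k\<bar>)\<^sup>2 \<le> 2 * (1 + k\<^sup>2)"
      using sum_squares_bound[of 1 "\<bar>k\<bar>"] by (simp add: power2_sum)
    then have "(1 + \<bar>k\<bar>)\<^sup>2 * (norm (complex_of_real (2 * pi) * u k))\<^sup>2 \<le> 2 * (1 + k\<^sup>2) * (norm (complex_of_real (2 * pi) * u k))\<^sup>2"
      by (intro mult_right_mono) auto
    then show ?thesis
      by (simp add: norm_mult power_mult_distrib algebra_simps)
  qed
  have b: "integrable lborel ?b"
    using Q by auto
  have w: "integrable lborel ?w"
    by (rule Bochner_Integration.integrable_bound[OF b])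
       (use le in \<open>auto intro!: AE_I2 order_trans[OF _ abs_ge_self]\<close>)
  show "h \<in> H1_space"
    unfolding H1_space_def L2_space_def using F w Q(2) fourier_pair_measurable(3)[OF P] by auto
  have "(\<integral>k. (1 + \<bar>k\<bar>)\<^sup>2 * (norm (fourier_L2 h k))\<^sup>2 \<partial>lborel) = (\<integral>k. ?w k \<partial>lborel)"
  proof (rule integral_cong_AE)
    have [measurable]: "fourier_L2 h \<in> borel_measurable borel"
      using fourier_L2_AE_eq(1)[OF _ F] by (auto simp: is_fourier_L2_def L2_space_def)
    show "(\<lambda>k. (1 + \<bar>k\<bar>)\<^sup>2 * (norm (fourier_L2 h k))\<^sup>2) \<in> borel_measurable lborel"
      by measurable
    show "AE k in lborel. (1 + \<bar>k\<bar>)\<^sup>2 * (norm (fourier_L2 h k))\<^sup>2 = ?w k"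
      using fourier_L2_AE_eq(2)[OF fourier_pair_measurable(2)[OF P] F] by eventually_elim simp
  qed measurable
  also have "\<dots> \<le> (\<integral>k. ?b k \<partial>lborel)"
    using le w b by (intro integral_mono)
  also have "\<dots> = 4 * pi * ((\<integral>x. (norm (h x))\<^sup>2 \<partial>lborel) + (\<integral>x. (norm (h' x))\<^sup>2 \<partial>lborel))"
  proof -
    have "(\<integral>k. ?b k \<partial>lborel)
        = 8 * pi\<^sup>2 * ((\<integral>k. (norm (u k))\<^sup>2 \<partial>lborel) + (\<integral>k. k\<^sup>2 * (norm (u k))\<^sup>2 \<partial>lborel))"
      using Q(1,4) by simp
    then show ?thesis
      unfolding Q(3,5) by (simp add: power2_eq_square[of pi] algebra_simps)
  qed
  finally show "H1_norm h \<le> sqrt (4 * pi * ((\<integral>x. (norm (h x))\<^sup>2 \<partial>lborel) + (\<integral>x. (norm (h' x))\<^sup>2 \<partial>lborel)))"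
    unfolding H1_norm_def by (rule real_sqrt_le_mono)
qed

section \<open>Fourier pairs of powers of the Moebius map\<close>

text \<open>Up to a constant factor the Erlang density. The half line is open, so the value at the
  possible jump 0 is 0.\<close>

definition power_exp :: "real \<Rightarrow> nat \<Rightarrow> real \<Rightarrow> complex" where
  "power_exp b m k = complex_of_real (indicator {0<..} k * (k ^ m * exp (- b * k)))"

lemma power_le_fact_exp:
  fixes y :: real
  assumes "y \<ge> 0"
  shows "y ^ m \<le> fact m * exp y"
proof -
  have "(\<Sum>n\<in>{m}. y ^ n /\<^sub>R fact n) \<le> (\<Sum>n. y ^ n /\<^sub>R fact n)"
    using assms by (intro sum_le_suminf summable_exp_generic) auto
  also have "\<dots> = exp y"
    by (simp add: exp_def)
  finally show ?thesis
    by (simp add: field_simps)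
qed

lemma times_power_exp: "of_real k * power_exp b m k = power_exp b (Suc m) k"
  by (simp add: power_exp_def)

lemma integrable_power_exp:
  assumes b: "b > 0"
  shows "integrable lborel (power_exp b m)"
proof -
  have "(\<integral>\<^sup>+x. ennreal (erlang_density m b x) \<partial>lborel) = 1"
    using nn_integral_erlang_ith_moment[OF b, of m 0] by simp
  then have "integrable lborel (erlang_density m b)"
    using b by (intro integrableI_nonneg) auto
  \<comment> \<open>For \<open>m = 0\<close> the Erlang density is nonzero at 0; the indicator
    removes that value to match \<open>power_exp\<close>.\<close>
  then have "integrable lborel (\<lambda>k. indicator {0<..} k *\<^sub>R (fact m / b ^ Suc m * erlang_density m b k))"
    by (intro integrable_mult_indicator integrable_mult_right) auto
  also have "(\<lambda>k. indicator {0<..} k *\<^sub>R (fact m / b ^ Suc m * erlang_density m b k))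
      = (\<lambda>k. indicator {0<..} k * (k ^ m * exp (- b * k)))"
    using b by (auto simp: erlang_density_def indicator_def fun_eq_iff)
  finally show ?thesis
    unfolding power_exp_def by (rule integrable_of_real)
qed

lemma norm_power_exp_le:
  assumes b: "b > 0"
  shows "norm (power_exp b m k) \<le> fact m / b ^ m"
proof (cases "k > 0")
  case True
  then have "(b * k) ^ m \<le> fact m * exp (b * k)"
    using b by (intro power_le_fact_exp) auto
  then show ?thesis
    using b True by (simp add: power_exp_def norm_mult norm_divide norm_power exp_minus field_simps power_mult_distrib)
qed (use b in \<open>auto simp: power_exp_def\<close>)

lemma isCont_power_exp:
  assumes "k \<noteq> 0"
  shows "isCont (power_exp b m) k"
  unfolding power_exp_def
  using assms by (intro continuous_intros) (auto simp: isCont_indicator)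

lemma tendsto_power_times_exp_at_top:
  fixes b :: real
  assumes b: "b > 0"
  shows "((\<lambda>k. k ^ m * exp (- b * k)) \<longlongrightarrow> 0) at_top"
proof -
  have "((\<lambda>k. (b * k) ^ m / exp (b * k)) \<longlongrightarrow> 0) at_top"
    by (rule filterlim_compose[OF tendsto_power_div_exp_0])
       (use b in \<open>auto intro!: filterlim_tendsto_pos_mult_at_top[OF tendsto_const] filterlim_ident\<close>)
  then have "((\<lambda>k. (1 / b ^ m) * ((b * k) ^ m / exp (b * k))) \<longlongrightarrow> (1 / b ^ m) * 0) at_top"
    by (intro tendsto_mult tendsto_const)
  then show ?thesis
    using b by (simp add: power_mult_distrib exp_minus field_simps)
qed

text \<open>Integration by parts against \<open>exp (- s * k)\<close> with
  \<open>s = b - \<i> * x\<close>. The term \<open>0 ^ m\<close> is the boundary value at 0, which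
  is 1 only for \<open>m = 0\<close>; in that case \<open>m - 1\<close> is 0, but its coefficient
  vanishes.\<close>

lemma fourier_integral_power_exp_rec:
  assumes b: "b > 0"
  shows "(of_real b - \<i> * of_real x) * fourier_integral (power_exp b m) x
    = of_nat m * fourier_integral (power_exp b (m - 1)) x + 0 ^ m"
proof -
  define s where "s = complex_of_real b - \<i> * of_real x"
  have e: "power_exp b m k * iexp (x * k) = indicator {0<..} k *\<^sub>R (of_real k ^ m * exp (- s * of_real k))" for m k
    by (auto simp: power_exp_def s_def indicator_def exp_of_real[symmetric] exp_add[symmetric] algebra_simps)
  define f where "f k = s * (of_real k ^ m * exp (- s * of_real k))
      - of_nat m * (of_real k ^ (m - 1) * exp (- s * of_real k))" for k :: real
  define F where "F k = - (of_real k ^ m * exp (- s * of_real k))" for k :: real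
  have int: "integrable lborel (\<lambda>k. indicator {0<..} k *\<^sub>R (of_real k ^ m * exp (- s * of_real k)))" for m
    using integrable_iexp_mult[OF integrable_power_exp[OF b], of m x] unfolding e .
  have if_eq: "indicator {0<..} k *\<^sub>R f k = s * (indicator {0<..} k *\<^sub>R (of_real k ^ m * exp (- s * of_real k)))
      - of_nat m * (indicator {0<..} k *\<^sub>R (of_real k ^ (m - 1) * exp (- s * of_real k)))" for k
    unfolding f_def by (simp add: scaleR_diff_right)
  have fint: "integrable lborel (\<lambda>k. indicator {0<..} k *\<^sub>R f k)"
    unfolding if_eq by (intro Bochner_Integration.integrable_diff integrable_mult_right int)
  have ei: "einterval 0 \<infinity> = {0<..}"
    by (auto simp: einterval_def zero_ereal_def)
  have "(LBINT k=0..\<infinity>. f k) = 0 - (- (0 ^ m))"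
  proof (rule interval_integral_FTC_integrable[where F = F])
    fix k :: real
    have "((\<lambda>z. - (z ^ m * exp (- s * z))) has_field_derivative
        s * (z ^ m * exp (- s * z)) - of_nat m * (z ^ (m - 1) * exp (- s * z))) (at z)" for z
      by (auto intro!: derivative_eq_intros simp: algebra_simps)
    then show "(F has_vector_derivative f k) (at k)"
      unfolding F_def f_def by (rule has_vector_derivative_real_field)
    show "isCont f k"
      unfolding f_def by (intro continuous_intros)
  next
    show "set_integrable lborel (einterval 0 \<infinity>) f"
      unfolding set_integrable_def ei by (rule fint)
    have "isCont F 0"
      unfolding F_def by (intro continuous_intros)
    then have "(F \<longlongrightarrow> F 0) (at_right 0)"
      by (simp add: isCont_def filterlim_at_split)
    then show "((F \<circ> real_of_ereal) \<longlongrightarrow> - (0 ^ m)) (at_right 0)"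
      unfolding zero_ereal_def ereal_tendsto_simps by (simp add: F_def)
    have "((\<lambda>k. norm (F k)) \<longlongrightarrow> 0) at_top"
    proof (rule Lim_transform_eventually[OF tendsto_power_times_exp_at_top[OF b, of m]])
      show "\<forall>\<^sub>F k in at_top. k ^ m * exp (- b * k) = norm (F k)"
        using eventually_ge_at_top[of 0]
        by eventually_elim (simp add: F_def norm_mult norm_power s_def)
    qed
    then show "((F \<circ> real_of_ereal) \<longlongrightarrow> 0) (at_left \<infinity>)"
      unfolding ereal_tendsto_simps by (rule tendsto_norm_zero_cancel)
  qed auto
  then have "(\<integral>k. indicator {0<..} k *\<^sub>R f k \<partial>lborel) = 0 ^ m"
    by (simp add: interval_lebesgue_integral_def ei set_lebesgue_integral_def)
  also have "(\<integral>k. indicator {0<..} k *\<^sub>R f k \<partial>lborel)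
      = s * fourier_integral (power_exp b m) x - of_nat m * fourier_integral (power_exp b (m - 1)) x"
    unfolding if_eq fourier_integral_def e
    by (subst Bochner_Integration.integral_diff) (use int in \<open>simp_all only: integrable_mult_right integral_mult_right_zero\<close>)
  finally show ?thesis
    unfolding s_def by (simp add: algebra_simps)
qed

lemma fourier_integral_power_exp:
  assumes b: "b > 0"
  shows "fourier_integral (power_exp b m) x = fact m / (of_real b - \<i> * of_real x) ^ Suc m"
proof -
  define s where "s = complex_of_real b - \<i> * of_real x"
  have s: "s \<noteq> 0"
    using b by (auto simp: s_def complex_eq_iff)
  note rec = fourier_integral_power_exp_rec[OF b, of x, folded s_def]
  have "fourier_integral (power_exp b m) x = fact m / s ^ Suc m"
  proof (induction m)
    case 0
    then show ?case
      using rec[of 0] s by (simp add: field_simps)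
  next
    case (Suc m)
    then have "s * fourier_integral (power_exp b (Suc m)) x = of_nat (Suc m) * (fact m / s ^ Suc m)"
      using rec[of "Suc m"] by simp
    then have "fourier_integral (power_exp b (Suc m)) x = of_nat (Suc m) * (fact m / s ^ Suc m) / s"
      using s by (metis nonzero_mult_div_cancel_left)
    then show ?case
      by (simp add: mult.commute)
  qed
  then show ?thesis
    unfolding s_def .
qed

text \<open>Multiplying by \<open>k\<close> raises \<open>m\<close> by one, and differentiating the
  rational function raises the order of its pole by one. The family is closed under both, which
  verifies the derivative clause.\<close>

lemma fourier_pair_power_exp:
  assumes b: "b > 0"
  shows "fourier_pair (power_exp b m) (\<lambda>x. fact m / (of_real b - \<i> * of_real x) ^ Suc m)"
proof -
  have "((\<lambda>x. fact m / (of_real b - \<i> * of_real x) ^ Suc m) has_vector_derivative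
      \<i> * (fact (Suc m) / (of_real b - \<i> * of_real x) ^ Suc (Suc m))) (at x)" for x :: real
  proof (rule has_vector_derivative_real_field)
    define s where "s = complex_of_real b - \<i> * of_real x"
    have s: "s \<noteq> 0"
      using b by (auto simp: s_def complex_eq_iff)
    have "((\<lambda>z. fact m / (of_real b - \<i> * z) ^ Suc m) has_field_derivative
        - (fact m * (of_nat (Suc m) * s ^ m * (- \<i>))) / (s ^ Suc m * s ^ Suc m)) (at (of_real x))"
      using s unfolding s_def by (auto intro!: derivative_eq_intros simp del: power_Suc)
    also have "- (fact m * (of_nat (Suc m) * s ^ m * (- \<i>))) / (s ^ Suc m * s ^ Suc m)
        = \<i> * (fact (Suc m) / s ^ Suc (Suc m))"
      using s by (simp add: field_simps)
    finally show "((\<lambda>z. fact m / (of_real b - \<i> * z) ^ Suc m) has_field_derivative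
        \<i> * (fact (Suc m) / (of_real b - \<i> * of_real x) ^ Suc (Suc m))) (at (of_real x))"
      unfolding s_def .
  qed
  moreover have "(\<lambda>k. \<i> * of_real k * power_exp b m k) = (\<lambda>k. \<i> * power_exp b (Suc m) k)"
    by (simp add: mult.assoc times_power_exp)
  ultimately show ?thesis
    unfolding fourier_pair_def times_power_exp
    using norm_power_exp_le[OF b, of m] norm_power_exp_le[OF b, of "Suc m"]
    by (auto simp: integrable_power_exp[OF b] isCont_power_exp fourier_integral_power_exp[OF b] fourier_integral_mult
        intro!: exI[of _ "max (fact m / b ^ m) (fact (Suc m) / b ^ Suc m)"] simp del: power_Suc fact_Suc)
       (auto simp: le_max_iff_disj simp del: power_Suc fact_Suc)
qed

section \<open>Powers of the Moebius map on the line\<close>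

lemma moebius_line:
  assumes "\<beta> > 0"
  shows "moebius_map \<beta> (of_real x) = 1 - 2 * \<beta> / (of_real \<beta> - \<i> * of_real x)"
proof -
  have nz: "complex_of_real x + \<i> * of_real \<beta> \<noteq> 0" "complex_of_real \<beta> - \<i> * of_real x \<noteq> 0"
    using assms by (auto simp: complex_eq_iff)
  then show ?thesis
    unfolding moebius_map_def by (simp add: divide_simps) (simp add: algebra_simps)
qed

lemma norm_moebius_line:
  assumes "\<beta> > 0"
  shows "norm (moebius_map \<beta> (of_real x)) = 1"
proof -
  have nz: "complex_of_real x + \<i> * of_real \<beta> \<noteq> 0"
    using assms by (auto simp: complex_eq_iff)
  have "cmod (of_real x - \<i> * of_real \<beta>) = cmod (of_real x + \<i> * of_real \<beta>)"
    by (simp add: cmod_def)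
  then show ?thesis
    using nz by (simp add: moebius_map_def norm_divide)
qed

lemma moebius_line_nonzero: "\<beta> > 0 \<Longrightarrow> moebius_map \<beta> (of_real x) \<noteq> 0"
  using norm_moebius_line[of \<beta> x] by auto

text \<open>Expand the power binomially with \<open>M = 1 - 2 * \<beta> / s\<close>, where
  \<open>s = \<beta> - \<i> * x\<close>. The constant term, which has no integrable amplitude, is
  the subtracted 1; the remaining powers of \<open>1 / s\<close> have the explicit amplitudes
  \<open>power_exp\<close>.\<close>

lemma fourier_pair_moebius_power:
  assumes \<beta>: "\<beta> > 0"
  shows "\<exists>u. fourier_pair u (\<lambda>x. moebius_map \<beta> (of_real x) ^ j - 1)"
proof -
  define s where "s x = complex_of_real \<beta> - \<i> * of_real x" for x
  have s: "s x \<noteq> 0" for x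
    using \<beta> by (auto simp: s_def complex_eq_iff)
  have "moebius_map \<beta> (of_real x) ^ j - 1
      = (\<Sum>m<j. of_nat (j choose Suc m) * (- 2 * of_real \<beta>) ^ Suc m / fact m * (fact m / s x ^ Suc m))" for x
  proof -
    have "moebius_map \<beta> (of_real x) ^ j = (- 2 * of_real \<beta> / s x + 1) ^ j"
      using moebius_line[OF \<beta>, of x] by (simp add: s_def)
    also have "\<dots> = (\<Sum>m\<le>j. of_nat (j choose m) * (- 2 * of_real \<beta> / s x) ^ m)"
      by (subst binomial_ring) simp
    also have "\<dots> = 1 + (\<Sum>m<j. of_nat (j choose Suc m) * (- 2 * of_real \<beta> / s x) ^ Suc m)"
      by (subst sum.atMost_shift) simp
    finally show ?thesis
      unfolding power_divide by (simp del: power_Suc binomial_Suc_Suc)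
  qed
  moreover have "\<exists>u. fourier_pair u (\<lambda>x. \<Sum>m<j. of_nat (j choose Suc m) * (- 2 * of_real \<beta>) ^ Suc m / fact m * (fact m / s x ^ Suc m))"
    unfolding s_def
    by (rule fourier_pair_sum, simp, rule exI, rule fourier_pair_mult, rule fourier_pair_power_exp[OF \<beta>])
  ultimately show ?thesis
    by simp
qed

text \<open>On the line \<open>M\<close> has modulus 1, so a negative power is the conjugate of a
  positive one.\<close>

lemma fourier_pair_moebius_powi:
  assumes \<beta>: "\<beta> > 0"
  shows "\<exists>u. fourier_pair u (\<lambda>x. moebius_map \<beta> (of_real x) powi p - 1)"
proof (cases "p \<ge> 0")
  case True
  then show ?thesis
    using fourier_pair_moebius_power[OF \<beta>, of "nat p"] by (simp add: power_int_def)
next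
  case False
  obtain u where "fourier_pair u (\<lambda>x. moebius_map \<beta> (of_real x) ^ nat (- p) - 1)"
    using fourier_pair_moebius_power[OF \<beta>] by blast
  from fourier_pair_cnj[OF this]
  have "fourier_pair (\<lambda>k. cnj (u (- k))) (\<lambda>x. cnj (moebius_map \<beta> (of_real x)) ^ nat (- p) - 1)"
    by simp
  moreover have "cnj (moebius_map \<beta> (of_real x)) = inverse (moebius_map \<beta> (of_real x))" for x
    using norm_moebius_line[OF \<beta>, of x]
    by (metis complex_norm_square inverse_unique mult.commute of_real_1 one_power2)
  ultimately show ?thesis
    using False by (auto simp: power_int_def)
qed

section \<open>The Sobolev bound\<close>

lemma integrable_inverse_1_plus_square_UNIV:
  "integrable lborel (\<lambda>x::real. inverse (1 + x\<^sup>2))"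
  "(\<integral>x. inverse (1 + (x::real)\<^sup>2) \<partial>lborel) = pi"
  using integrable_inverse_1_plus_square LBINT_inverse_1_plus_square
  by (simp_all add: set_integrable_def interval_lebesgue_integral_def set_lebesgue_integral_def einterval_def)

text \<open>A pointwise stand-in for the Cauchy-Schwarz inequality: it dominates a product by two
  integrable squares. The lost factor 1/2 is immaterial.\<close>

lemma mult_le_sum_squares:
  fixes a b :: real
  assumes "0 \<le> a" "0 \<le> b"
  shows "a * b \<le> a\<^sup>2 + b\<^sup>2"
  using sum_squares_bound[of a b] mult_nonneg_nonneg[OF assms] by linarith

lemma gaussian_le_inverse_square:
  assumes "u \<noteq> 0"
  shows "gaussian u \<le> 1 / u\<^sup>2"
proof -
  have "u\<^sup>2 / 2 \<le> exp (u\<^sup>2 / 2)"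
    using exp_ge_add_one_self[of "u\<^sup>2 / 2"] by linarith
  then have "exp (- u\<^sup>2 / 2) \<le> 2 / u\<^sup>2"
    using assms by (simp add: exp_minus field_simps)
  moreover have "1 / sqrt (2 * pi) \<le> 1 / 2"
    using real_sqrt_le_mono[of 4 "2 * pi"] pi_gt3 by (simp add: field_simps)
  ultimately have "1 / sqrt (2 * pi) * exp (- u\<^sup>2 / 2) \<le> 1 / 2 * (2 / u\<^sup>2)"
    by (intro mult_mono) auto
  then show ?thesis
    by (simp add: std_normal_density_def)
qed

lemma gaussian_le_1: "gaussian u \<le> 1"
proof -
  have "1 / sqrt (2 * pi) \<le> 1"
    using real_sqrt_le_mono[of 1 "2 * pi"] pi_gt3 by (simp add: field_simps)
  then have "1 / sqrt (2 * pi) * exp (- u\<^sup>2 / 2) \<le> 1 * 1"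
    by (intro mult_mono) auto
  then show ?thesis
    by (simp add: std_normal_density_def)
qed

text \<open>A smoothed inversion formula: 2 pi times the Gaussian average of \<open>f\<close> at
  \<open>x\<close> is the integral of \<open>\<psi> k * g k\<close>, with \<open>\<psi>\<close>
  bounded by 1. Truncations of \<open>f\<close> are integrable, so Fubini proves it for them, and
  both sides then pass to the limit in the truncation radius.\<close>

lemma fourier_L2_gaussian_bound:
  assumes f: "f \<in> L2_space" and g: "is_fourier_L2 f g" "integrable lborel g" and e: "e > 0"
  shows "2 * pi * norm (\<integral>s. f (x - e * s) * gaussian s \<partial>lborel) \<le> (\<integral>k. norm (g k) \<partial>lborel)"
proof -
  have [measurable]: "f \<in> borel_measurable borel" "g \<in> borel_measurable borel"
    and f2: "integrable lborel (\<lambda>y. (norm (f y))\<^sup>2)"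
    using f g by (auto simp: is_fourier_L2_def L2_space_def)
  define fr where "fr r y = indicator {-r..r} y *\<^sub>R f y" for r y
  define W where "W k = complex_of_real (exp (- (e * k)\<^sup>2 / 2))" for k
  define \<psi> where "\<psi> k = W k * iexp (k * x)" for k
  define T where "T r = fourier_trunc f r" for r
  define K where "K y = 2 * pi / e * gaussian ((x - y) / e)" for y
  have [measurable]: "fr r \<in> borel_measurable borel" "W \<in> borel_measurable borel"
    "\<psi> \<in> borel_measurable borel" "K \<in> borel_measurable borel" "T r \<in> borel_measurable borel" for r
    unfolding fr_def W_def \<psi>_def K_def T_def using fourier_trunc_measurable by measurable
  have W: "integrable lborel W"
    unfolding W_def using integrable_exp_square[OF e] by simp
  have \<psi>: "integrable lborel \<psi>"
    unfolding \<psi>_def by (rule Bochner_Integration.integrable_bound[OF W]) (auto simp: norm_mult)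
  have \<psi>1: "norm (\<psi> k) \<le> 1" for k
    by (simp add: \<psi>_def W_def norm_mult)
  have fr_int: "integrable lborel (fr r)" for r
  proof (rule Bochner_Integration.integrable_bound)
    show "integrable lborel (\<lambda>y. indicator {-r..r} y + (norm (f y))\<^sup>2)"
      using f2 by (intro Bochner_Integration.integrable_add integrable_real_indicator)
        (auto simp: emeasure_lborel_Icc_eq)
    have "norm z \<le> 1 + (norm z)\<^sup>2" for z :: complex
      using mult_le_sum_squares[of 1 "norm z"] by simp
    then show "AE y in lborel. norm (fr r y) \<le> norm (indicator {-r..r} y + (norm (f y))\<^sup>2)"
      by (auto simp: fr_def indicator_def)
  qed measurable
  have T_eq: "T r k = (\<integral>y. fr r y * iexp (- k * y) \<partial>lborel)" for r k
    unfolding T_def fourier_trunc_eq_fourier_integral fr_def fourier_integral_def by (simp add: mult.commute)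
  have inner: "(\<integral>k. \<psi> k * iexp (- k * y) \<partial>lborel) = K y" for y
  proof -
    have "(\<integral>k. \<psi> k * iexp (- k * y) \<partial>lborel) = (\<integral>k. W k * iexp (k * (x - y)) \<partial>lborel)"
      unfolding \<psi>_def by (intro Bochner_Integration.integral_cong)
        (auto simp: exp_add[symmetric] algebra_simps)
    then show ?thesis
      unfolding W_def K_def fourier_integral_gaussian[OF e] .
  qed
  have pair: "(\<integral>k. \<psi> k * T r k \<partial>lborel) = (\<integral>y. fr r y * K y \<partial>lborel)" for r
  proof -
    have "(\<integral>k. \<psi> k * T r k \<partial>lborel) = (\<integral>y. fr r y * (\<integral>k. \<psi> k * iexp (- k * y) \<partial>lborel) \<partial>lborel)"
      unfolding T_eq by (rule lborel_pair.Fubini_bounded[OF \<psi> fr_int, where B = 1]) auto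
    then show ?thesis
      unfolding inner .
  qed
  have T_bd: "norm (T r k) \<le> (\<integral>y. norm (fr r y) \<partial>lborel)" for r k
    using norm_fourier_integral_le[OF fr_int, of r "- k"] unfolding T_def fourier_trunc_eq_fourier_integral fr_def .
  have \<psi>T: "integrable lborel (\<lambda>k. \<psi> k * T r k)" for r
  proof (rule Bochner_Integration.integrable_bound[of _ "\<lambda>k. (\<integral>y. norm (fr r y) \<partial>lborel) *\<^sub>R norm (\<psi> k)"])
    show "AE k in lborel. norm (\<psi> k * T r k) \<le> norm ((\<integral>y. norm (fr r y) \<partial>lborel) *\<^sub>R norm (\<psi> k))"
      using mult_left_mono[OF T_bd[of r] norm_ge_zero[of "\<psi> _"]]
      by (auto simp: norm_mult abs_mult mult.commute)
  qed (use \<psi> in auto)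
  have \<psi>g: "integrable lborel (\<lambda>k. \<psi> k * g k)"
    by (rule Bochner_Integration.integrable_bound[OF g(2)])
       (use \<psi>1 in \<open>auto simp: norm_mult intro!: mult_left_le_one_le\<close>)
  \<comment> \<open>Mean convergence of the truncated transforms becomes convergence of these
    integrals by Cauchy-Schwarz against the square integrable \<open>\<psi>\<close>.\<close>
  have "(\<lambda>n. \<integral>k. \<psi> k * T (real n) k \<partial>lborel) \<longlonglongrightarrow> (\<integral>k. \<psi> k * g k \<partial>lborel)"
  proof -
    define D where "D r = (\<integral>\<^sup>+k. ennreal ((norm (T r k - g k))\<^sup>2) \<partial>lborel)" for r
    define P where "P = (\<integral>\<^sup>+k. ennreal ((norm (\<psi> k))\<^sup>2) \<partial>lborel)"
    have P: "P < \<infinity>"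
    proof -
      have "P \<le> (\<integral>\<^sup>+k. ennreal (norm (\<psi> k)) \<partial>lborel)"
        unfolding P_def using \<psi>1 by (intro nn_integral_mono ennreal_leI) (simp add: power2_eq_square mult_left_le)
      also have "\<dots> < \<infinity>"
        using \<psi> by (simp add: integrable_iff_bounded)
      finally show ?thesis .
    qed
    have "(D \<longlongrightarrow> 0) at_top"
      using g(1) unfolding D_def T_def is_fourier_L2_def by simp
    then have "(\<lambda>n. D (real n)) \<longlonglongrightarrow> 0"
      by (rule filterlim_compose) (rule filterlim_real_sequentially)
    then have "(\<lambda>n. P * D (real n)) \<longlonglongrightarrow> P * 0"
      using P by (intro ennreal_tendsto_cmult) auto
    then have lim: "(\<lambda>n. P * D (real n)) \<longlonglongrightarrow> ennreal 0"
      by simp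
    have le: "ennreal ((norm ((\<integral>k. \<psi> k * T r k \<partial>lborel) - (\<integral>k. \<psi> k * g k \<partial>lborel)))\<^sup>2) \<le> P * D r" for r
    proof -
      have "(\<integral>k. \<psi> k * T r k \<partial>lborel) - (\<integral>k. \<psi> k * g k \<partial>lborel) = (\<integral>k. \<psi> k * (T r k - g k) \<partial>lborel)"
        using \<psi>T \<psi>g by (simp add: right_diff_distrib)
      moreover have "ennreal (norm (\<integral>k. \<psi> k * (T r k - g k) \<partial>lborel)) \<le> (\<integral>\<^sup>+k. norm (\<psi> k * (T r k - g k)) \<partial>lborel)"
        by (rule integral_norm_bound_ennreal) (use \<psi>T \<psi>g in \<open>simp add: right_diff_distrib\<close>)
      ultimately have "(ennreal (norm ((\<integral>k. \<psi> k * T r k \<partial>lborel) - (\<integral>k. \<psi> k * g k \<partial>lborel))))\<^sup>2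
          \<le> (\<integral>\<^sup>+k. ennreal (norm (\<psi> k)) * ennreal (norm (T r k - g k)) \<partial>lborel)\<^sup>2"
        by (intro power_mono) (auto simp: norm_mult ennreal_mult)
      also have "\<dots> \<le> (\<integral>\<^sup>+k. (ennreal (norm (\<psi> k)))\<^sup>2 \<partial>lborel) * (\<integral>\<^sup>+k. (ennreal (norm (T r k - g k)))\<^sup>2 \<partial>lborel)"
        by (rule Cauchy_Schwarz_nn_integral) measurable
      finally show ?thesis
        by (simp add: P_def D_def ennreal_power)
    qed
    have "(\<lambda>n. ennreal ((norm ((\<integral>k. \<psi> k * T (real n) k \<partial>lborel) - (\<integral>k. \<psi> k * g k \<partial>lborel)))\<^sup>2)) \<longlonglongrightarrow> ennreal 0"
      by (rule tendsto_sandwich[OF _ _ tendsto_const lim]) (use le in auto)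
    then have "(\<lambda>n. (norm ((\<integral>k. \<psi> k * T (real n) k \<partial>lborel) - (\<integral>k. \<psi> k * g k \<partial>lborel)))\<^sup>2) \<longlonglongrightarrow> 0"
      by (subst (asm) tendsto_ennreal_iff) auto
    from tendsto_real_sqrt[OF this] show ?thesis
      by (simp add: tendsto_norm_zero_iff LIM_zero_iff)
  qed
  moreover have "(\<lambda>n. \<integral>y. fr (real n) y * K y \<partial>lborel) \<longlonglongrightarrow> (\<integral>y. f y * K y \<partial>lborel)"
  \<comment> \<open>The dominating function comes from |f| K \<le> |f|^2 + K^2 and
    \<open>K y \<le> 2 * pi / e\<close>.\<close>
  proof (rule integral_dominated_convergence[where w = "\<lambda>y. (norm (f y))\<^sup>2 + 2 * pi / e * K y"])
    have K0: "0 \<le> K y" for y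
      using e by (simp add: K_def)
    have Ki: "integrable lborel K"
      unfolding K_def using e lborel_integrable_real_affine[OF gaussian_integrable, of "- 1 / e" "x / e"]
      by (simp add: diff_divide_distrib)
    then show "integrable lborel (\<lambda>y. (norm (f y))\<^sup>2 + 2 * pi / e * K y)"
      using f2 by auto
    have "norm (f y) * K y \<le> (norm (f y))\<^sup>2 + 2 * pi / e * K y" for y
    proof -
      have "norm (f y) * K y \<le> (norm (f y))\<^sup>2 + K y * K y"
        using mult_le_sum_squares[OF norm_ge_zero K0] by (simp add: power2_eq_square)
      also have "K y * K y \<le> 2 * pi / e * K y"
        using K0 e gaussian_le_1[of "(x - y) / e"] unfolding K_def
        by (intro mult_right_mono) (auto simp: field_simps)
      finally show ?thesis by simp
    qed
    then show "AE y in lborel. norm (fr (real n) y * K y) \<le> (norm (f y))\<^sup>2 + 2 * pi / e * K y" for n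
      using K0 e by (auto simp: fr_def indicator_def norm_mult)
    show "AE y in lborel. (\<lambda>n. fr (real n) y * K y) \<longlonglongrightarrow> f y * K y"
    proof (rule AE_I2, rule tendsto_eventually)
      fix y :: real
      show "\<forall>\<^sub>F n in sequentially. fr (real n) y * K y = f y * K y"
        using eventually_ge_at_top[of "nat \<lceil>\<bar>y\<bar>\<rceil>"]
        by eventually_elim (auto simp: fr_def indicator_def)
    qed
  qed measurable
  ultimately have "(\<integral>y. f y * K y \<partial>lborel) = (\<integral>k. \<psi> k * g k \<partial>lborel)"
    unfolding pair using LIMSEQ_unique by blast
  then have "2 * pi * (\<integral>s. f (x - e * s) * gaussian s \<partial>lborel) = (\<integral>k. \<psi> k * g k \<partial>lborel)"
    unfolding gaussian_convolution[OF e, symmetric] K_def .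
  then have "2 * pi * norm (\<integral>s. f (x - e * s) * gaussian s \<partial>lborel) = norm (\<integral>k. \<psi> k * g k \<partial>lborel)"
    by (auto simp: norm_mult dest: arg_cong[where f = norm])
  also have "\<dots> \<le> (\<integral>k. norm (\<psi> k * g k) \<partial>lborel)"
    by (rule integral_norm_bound)
  also have "\<dots> \<le> (\<integral>k. norm (g k) \<partial>lborel)"
    using integrable_norm[OF \<psi>g] g(2) \<psi>1 by (intro integral_mono) (auto simp: norm_mult intro!: mult_left_le_one_le)
  finally show ?thesis .
qed

text \<open>\<open>f\<close> is continuous but not yet known to be bounded, so the approximate
  identity is applied only to the part \<open>f1\<close> near \<open>x\<close>. The far part
  \<open>f2\<close> is square integrable, and the Gaussian tail makes its contribution O(e).\<close>

lemma norm_le_integral_fourier_L2: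
  assumes f: "f \<in> L2_space" "continuous_on UNIV f" and g: "is_fourier_L2 f g" "integrable lborel g"
  shows "2 * pi * norm (f x) \<le> (\<integral>k. norm (g k) \<partial>lborel)"
proof -
  have [measurable]: "f \<in> borel_measurable borel"
    and f2: "integrable lborel (\<lambda>y. (norm (f y))\<^sup>2)"
    using f g by (auto simp: is_fourier_L2_def L2_space_def)
  define f1 where "f1 y = indicator {x - 1..x + 1} y *\<^sub>R f y" for y
  define f2 where "f2 y = indicator (- {x - 1..x + 1}) y *\<^sub>R f y" for y
  have [measurable]: "f1 \<in> borel_measurable borel" "f2 \<in> borel_measurable borel"
    unfolding f1_def f2_def by measurable
  have split: "f y = f1 y + f2 y" for y
    by (simp add: f1_def f2_def indicator_def)
  have "compact (f ` {x - 1..x + 1})"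
    using f(2) by (intro compact_continuous_image continuous_on_subset[OF f(2)]) auto
  then obtain B where B': "\<forall>z\<in>f ` {x - 1..x + 1}. norm z \<le> B"
    using compact_imp_bounded[of "f ` {x - 1..x + 1}"] by (auto simp: bounded_iff)
  have B: "norm (f y) \<le> B" if "y \<in> {x - 1..x + 1}" for y
    using B' that by simp
  have B0: "B \<ge> 0"
    using order_trans[OF norm_ge_zero B[of x]] by simp
  have f1B: "norm (f1 y) \<le> B" for y
    using B B0 by (auto simp: f1_def indicator_def)
  have f1c: "isCont f1 x"
  proof -
    have "isCont f x"
      using f(2) by (simp add: continuous_on_eq_continuous_at)
    then show ?thesis
      unfolding f1_def by (intro continuous_intros)
        (auto simp: isCont_indicator frontier_def interior_atLeastAtMost_real)
  qed
  \<comment> \<open>The 2 pi is the integral of 2 / (1 + (x - y)^2), which accounts for the Gaussian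
    tail.\<close>
  define C where "C = (\<integral>y. (norm (f y))\<^sup>2 \<partial>lborel) + 2 * pi"
  have tail: "norm (\<integral>s. f2 (x - e * s) * gaussian s \<partial>lborel) \<le> e * C \<and>
      integrable lborel (\<lambda>s. f2 (x - e * s) * gaussian s)" if e: "e > 0" for e
  proof -
    define w where "w y = (norm (f y))\<^sup>2 + 2 * inverse (1 + (x - y)\<^sup>2)" for y
    have wi: "integrable lborel (\<lambda>y. inverse (1 + (x - y)\<^sup>2))"
      using lborel_integrable_real_affine[OF integrable_inverse_1_plus_square_UNIV(1), of "- 1" x] by simp
    have wI: "(\<integral>y. inverse (1 + (x - y)\<^sup>2) \<partial>lborel) = pi"
      using lborel_integral_real_affine[of "- 1" "\<lambda>x. inverse (1 + x\<^sup>2)" x]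
        integrable_inverse_1_plus_square_UNIV(2) by simp
    have w: "integrable lborel w" "(\<integral>y. w y \<partial>lborel) = C"
      unfolding w_def C_def using wi wI \<open>integrable lborel (\<lambda>y. (norm (f y))\<^sup>2)\<close> by simp_all
    \<comment> \<open>The tail bound \<open>gaussian u \<le> 1 / u\<^sup>2\<close> gains e^2, and
      undoing the substitution costs 1 / e; a factor \<open>e\<close> survives.\<close>
    have bd: "norm (f2 y * gaussian ((x - y) / e)) \<le> e\<^sup>2 * w y" for y
    proof (cases "y \<in> {x - 1..x + 1}")
      case True
      then show ?thesis by (simp add: f2_def w_def)
    next
      case False
      define t where "t = x - y"
      have t: "t\<^sup>2 \<ge> 1" "t \<noteq> 0"
        using False abs_le_square_iff[of 1 t] by (auto simp: t_def)
      have "gaussian (t / e) \<le> e\<^sup>2 * (1 / t\<^sup>2)"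
        using gaussian_le_inverse_square[of "t / e"] t e by (simp add: power_divide)
      then have "norm (f y) * gaussian (t / e) \<le> norm (f y) * (e\<^sup>2 * (1 / t\<^sup>2))"
        by (intro mult_left_mono) auto
      also have "\<dots> = e\<^sup>2 * (norm (f y) * (1 / t\<^sup>2))"
        by simp
      also have "\<dots> \<le> e\<^sup>2 * ((norm (f y))\<^sup>2 + 2 * inverse (1 + t\<^sup>2))"
      proof (rule mult_left_mono)
        have "norm (f y) * (1 / t\<^sup>2) \<le> (norm (f y))\<^sup>2 + (1 / t\<^sup>2)\<^sup>2"
          by (rule mult_le_sum_squares) auto
        moreover have "(1 / t\<^sup>2)\<^sup>2 \<le> 1 / t\<^sup>2"
          unfolding power2_eq_square[of "1 / t\<^sup>2"] using t by (intro mult_left_le) auto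
        moreover have "1 / t\<^sup>2 \<le> 2 * inverse (1 + t\<^sup>2)"
          using t by (simp add: field_simps add_pos_nonneg)
        ultimately show "norm (f y) * (1 / t\<^sup>2) \<le> (norm (f y))\<^sup>2 + 2 * inverse (1 + t\<^sup>2)"
          by linarith
      qed simp
      finally show ?thesis
        using False by (simp add: f2_def w_def norm_mult t_def)
    qed
    have i: "integrable lborel (\<lambda>y. f2 y * gaussian ((x - y) / e))"
      by (rule Bochner_Integration.integrable_bound[of _ "\<lambda>y. e\<^sup>2 * w y"])
        (use w bd in \<open>auto intro!: AE_I2 order_trans[OF _ abs_ge_self]\<close>)
    have "(\<integral>s. f2 (x - e * s) * gaussian s \<partial>lborel) = (1 / e) *\<^sub>R (\<integral>y. f2 y * gaussian ((x - y) / e) \<partial>lborel)"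
      using e by (subst (2) lborel_integral_real_affine[where c = "- e" and t = x]) auto
    then have "norm (\<integral>s. f2 (x - e * s) * gaussian s \<partial>lborel)
        = (1 / e) * norm (\<integral>y. f2 y * gaussian ((x - y) / e) \<partial>lborel)"
      using e by simp
    also have "\<dots> \<le> (1 / e) * (\<integral>y. norm (f2 y * gaussian ((x - y) / e)) \<partial>lborel)"
      using e by (intro mult_left_mono integral_norm_bound) auto
    also have "\<dots> \<le> (1 / e) * (\<integral>y. e\<^sup>2 * w y \<partial>lborel)"
      using e w bd integrable_norm[OF i] by (intro mult_left_mono integral_mono) auto
    also have "\<dots> = e * C"
      using e w by (simp add: power2_eq_square)
    finally show ?thesis
      using lborel_integrable_real_affine[OF i, of "- e" x] e by simp
  qed
  define A where "A = (\<integral>k. norm (g k) \<partial>lborel)"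
  define e where "e j = inverse (real (Suc j))" for j
  have e0: "e j > 0" for j
    by (simp add: e_def)
  have e: "e \<longlonglongrightarrow> 0"
    unfolding e_def by (rule LIMSEQ_inverse_real_of_nat)
  have le: "2 * pi * norm (\<integral>s. f1 (x - e j * s) * gaussian s \<partial>lborel) \<le> A + 2 * pi * (e j * C)" for j
  proof -
    let ?I = "\<lambda>f :: real \<Rightarrow> complex. \<integral>s. f (x - e j * s) * complex_of_real (gaussian s) \<partial>lborel"
    have "integrable lborel (\<lambda>s. f1 (x - e j * s) * gaussian s)"
      by (rule gaussian_bounded_integrable[of _ B]) (use f1B in auto)
    then have "?I f = ?I f1 + ?I f2"
      using tail[OF e0[of j]] unfolding split by (simp add: distrib_right)
    then have "?I f1 = ?I f - ?I f2"
      by simp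
    then have "norm (?I f1) \<le> norm (?I f) + norm (?I f2)"
      by (simp only: norm_triangle_ineq4)
    also have "norm (?I f2) \<le> e j * C"
      using tail[OF e0[of j]] by blast
    finally have "2 * pi * norm (?I f1) \<le> 2 * pi * (norm (?I f) + e j * C)"
      by (intro mult_left_mono) auto
    also have "\<dots> \<le> A + 2 * pi * (e j * C)"
      using fourier_L2_gaussian_bound[OF f(1) g e0[of j], of x] by (simp add: distrib_left A_def)
    finally show ?thesis .
  qed
  have "(\<lambda>j. 2 * pi * norm (\<integral>s. f1 (x - e j * s) * gaussian s \<partial>lborel)) \<longlonglongrightarrow> 2 * pi * norm (f1 x)"
    by (intro tendsto_intros gaussian_approximate_identity[OF _ f1B f1c e]) measurable
  moreover have "(\<lambda>j. A + 2 * pi * (e j * C)) \<longlonglongrightarrow> A + 2 * pi * (0 * C)"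
    by (intro tendsto_intros e)
  ultimately have "2 * pi * norm (f1 x) \<le> A + 2 * pi * (0 * C)"
    by (rule LIMSEQ_le) (use le in auto)
  then show ?thesis
    by (simp add: f1_def A_def)
qed

text \<open>Pointwise |g| \<le> (1 + |k|)^2 |g|^2 + 1 / (1 + k^2), so the integral of |g| is at most
  1 + pi \<le> 2 pi. The normalisation of the transform thus places the unit ball of H1 inside that
  of the supremum norm, without a further constant.\<close>

lemma H1_norm_le_1_imp_norm_le_1:
  assumes f: "f \<in> H1_space" and le: "H1_norm f \<le> 1"
  shows "norm (f x) \<le> 1"
proof -
  define g where "g = fourier_L2 f"
  obtain g' where g': "is_fourier_L2 f g'" "integrable lborel (\<lambda>k. (1 + \<bar>k\<bar>)\<^sup>2 * (norm (g' k))\<^sup>2)"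
    and fL: "f \<in> L2_space" "continuous_on UNIV f"
    using f by (auto simp: H1_space_def)
  have fm [measurable]: "f \<in> borel_measurable borel"
    using fL by (auto simp: L2_space_def)
  have g: "is_fourier_L2 f g" and gg': "AE k in lborel. g k = g' k"
    unfolding g_def by (rule fourier_L2_AE_eq[OF fm g'(1)])+
  have [measurable]: "g \<in> borel_measurable borel" "g' \<in> borel_measurable borel"
    using g g'(1) by (auto simp: is_fourier_L2_def L2_space_def)
  let ?w = "\<lambda>k. (1 + \<bar>k\<bar>)\<^sup>2 * (norm (g k))\<^sup>2"
  \<comment> \<open>Weighted integrability is given for some version \<open>g'\<close> and carries
    over to the chosen one.\<close>
  have w: "integrable lborel ?w"
    by (rule integrable_cong_AE_imp[OF g'(2)]) (use gg' in \<open>measurable, eventually_elim, simp\<close>)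
  have wI: "(\<integral>k. ?w k \<partial>lborel) \<le> 1"
    using le by (simp add: H1_norm_def g_def)
  have pt: "norm (g k) \<le> ?w k + inverse (1 + k\<^sup>2)" for k
  proof -
    have "norm (g k) = ((1 + \<bar>k\<bar>) * norm (g k)) * inverse (1 + \<bar>k\<bar>)"
      by simp
    also have "\<dots> \<le> ((1 + \<bar>k\<bar>) * norm (g k))\<^sup>2 + (inverse (1 + \<bar>k\<bar>))\<^sup>2"
      by (rule mult_le_sum_squares) auto
    also have "(inverse (1 + \<bar>k\<bar>))\<^sup>2 \<le> inverse (1 + k\<^sup>2)"
      unfolding power_inverse by (rule le_imp_inverse_le) (auto simp: power2_sum add_pos_nonneg)
    finally show ?thesis
      by (simp add: power_mult_distrib)
  qed
  have b: "integrable lborel (\<lambda>k. ?w k + inverse (1 + k\<^sup>2))"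
    using w integrable_inverse_1_plus_square_UNIV(1) by auto
  have gi: "integrable lborel g"
    by (rule Bochner_Integration.integrable_bound[OF b])
       (use pt in \<open>auto intro!: AE_I2 order_trans[OF _ abs_ge_self]\<close>)
  have "2 * pi * norm (f x) \<le> (\<integral>k. norm (g k) \<partial>lborel)"
    by (rule norm_le_integral_fourier_L2[OF fL g gi])
  also have "\<dots> \<le> (\<integral>k. ?w k + inverse (1 + k\<^sup>2) \<partial>lborel)"
    using pt gi b by (intro integral_mono) auto
  also have "\<dots> = (\<integral>k. ?w k \<partial>lborel) + pi"
    using w integrable_inverse_1_plus_square_UNIV by simp
  also have "\<dots> \<le> 2 * pi * 1"
    using wI pi_gt3 by simp
  finally show ?thesis
    by (metis mult_le_cancel_left_pos mult_pos_pos pi_gt_zero zero_less_numeral)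
qed

section \<open>The Lebesgue constant\<close>

text \<open>A weak form of Jordan's inequality sin (pi x) \<ge> 2 x. The cubic Taylor estimate on
  [0, 2] gives sin y \<ge> y - y^3 / 6 \<ge> y / 3, and pi > 3 does the rest.\<close>

lemma sin_pi_ge:
  fixes x :: real
  assumes "0 \<le> x" "x \<le> 1/2"
  shows "x \<le> sin (pi * x)"
proof -
  define y where "y = pi * x"
  have y: "0 \<le> y" "y \<le> 2"
    using assms pi_less_4 mult_mono[of pi 4 x "1/2"] by (auto simp: y_def)
  have "\<bar>sin y - (\<Sum>m<3. sin_coeff m * y ^ m)\<bar> \<le> inverse (fact 3) * \<bar>y\<bar> ^ 3"
    by (rule Maclaurin_sin_bound)
  then have "\<bar>sin y - y\<bar> \<le> y ^ 3 / 6"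
    using y by (simp add: sin_coeff_def eval_nat_numeral)
  moreover have "y ^ 3 \<le> 4 * y"
    using y mult_mono[of "y * y" "2 * 2" y y] mult_mono[of y 2 y 2] by (simp add: eval_nat_numeral)
  ultimately have "y / 3 \<le> sin y"
    by linarith
  moreover have "x \<le> y / 3"
    using assms pi_gt3 mult_right_mono[of 3 pi x] by (simp add: y_def)
  ultimately show ?thesis
    by (simp add: y_def)
qed

lemma norm_sum_iexp_le_card: "norm (\<Sum>j<m. exp (\<i> * of_int (a + int j) * of_real \<phi>)) \<le> real m"
proof -
  have "norm (exp (\<i> * of_int (a + int j) * of_real \<phi>)) = 1" for j
    by (simp add: norm_exp_eq_Re)
  then show ?thesis
    using norm_sum[of "\<lambda>j. exp (\<i> * of_int (a + int j) * of_real \<phi>)" "{..<m}"] by simp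
qed

lemma iexp_int_add: "exp (\<i> * of_int (a + int j) * of_real \<phi>) = exp (\<i> * of_int a * of_real \<phi>) * exp (\<i> * of_real \<phi>) ^ j"
  by (simp add: exp_of_nat_mult[symmetric] exp_add[symmetric] algebra_simps)

text \<open>Geometric sum: |w - 1| is 2 |sin (\<phi> / 2)|, and the numerator has modulus at most 2.
  The product form covers the zeros of the sine.\<close>

lemma norm_sum_iexp_sin:
  "norm (\<Sum>j<m. exp (\<i> * of_int (a + int j) * of_real \<phi>)) * \<bar>sin (\<phi> / 2)\<bar> \<le> 1"
proof -
  let ?w = "exp (\<i> * complex_of_real \<phi>)"
  have "(?w - 1) * (\<Sum>j<m. exp (\<i> * of_int (a + int j) * of_real \<phi>))
      = exp (\<i> * of_int a * of_real \<phi>) * ((?w - 1) * (\<Sum>j<m. ?w ^ j))"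
    unfolding iexp_int_add sum_distrib_left[symmetric] by (simp add: mult_ac)
  also have "\<dots> = exp (\<i> * of_int a * of_real \<phi>) * (?w ^ m - 1)"
    by (simp only: power_diff_1_eq)
  finally have "norm (?w - 1) * norm (\<Sum>j<m. exp (\<i> * of_int (a + int j) * of_real \<phi>)) = norm (?w ^ m - 1)"
    by (simp add: norm_mult[symmetric]) (simp add: norm_mult norm_exp_eq_Re)
  also have "\<dots> \<le> norm (?w ^ m) + norm (1::complex)"
    by (rule norm_triangle_ineq4)
  also have "\<dots> = 2"
    by (simp add: norm_power)
  finally show ?thesis
    unfolding dist_exp_i_1 by (simp add: mult.commute)
qed

text \<open>The variable \<open>t = n \<theta> / 2 pi\<close> is the angle measured in units of the node spacing.\<close>

lemma kernel_bound:
  fixes t :: real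
  assumes l: "l < n" and t: "0 \<le> t" "t < real n" and m: "m \<le> n"
  defines "u \<equiv> \<bar>t - real l\<bar>"
  shows "norm (\<Sum>j<m. exp (\<i> * of_int (a + int j) * of_real (2 * pi * (t - real l) / real n)))
    \<le> real n * (2 / (1 + u) + 2 / (1 + real n - u))"
proof -
  define D where "D = norm (\<Sum>j<m. exp (\<i> * of_int (a + int j) * of_real (2 * pi * (t - real l) / real n)))"
  have n: "real n > 0" using l by simp
  have u: "0 \<le> u" "u < real n"
    using l t by (auto simp: u_def)
  have Dn: "D \<le> real n"
    using norm_sum_iexp_le_card[of a "2 * pi * (t - real l) / real n" m] m unfolding D_def by simp
  have "\<bar>sin (2 * pi * (t - real l) / real n / 2)\<bar> = \<bar>sin (pi * (u / real n))\<bar>"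
  proof (cases "t \<ge> real l")
    case False
    then have "2 * pi * (t - real l) / real n / 2 = - (pi * (u / real n))"
      using n by (simp add: u_def field_simps)
    then show ?thesis
      by (simp only: sin_minus abs_minus_cancel)
  qed (simp add: u_def)
  then have Ds: "D * \<bar>sin (pi * (u / real n))\<bar> \<le> 1"
    using norm_sum_iexp_sin[of a "2 * pi * (t - real l) / real n" m] unfolding D_def by simp
  have D0: "D \<ge> 0"
    by (simp add: D_def)
  \<comment> \<open>\<open>v\<close> is a distance in node spacings. For \<open>v \<le> 1\<close>
    counting terms suffices; beyond that n / v \<le> 2 n / (1 + v).\<close>
  have aux: "D \<le> real n * (2 / (1 + v))" if v: "0 \<le> v" "v / real n \<le> \<bar>sin (pi * (u / real n))\<bar>" for v
  proof (cases "v \<le> 1")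
    case True
    then have "real n * 1 \<le> real n * (2 / (1 + v))"
      using v n by (intro mult_left_mono) (auto simp: field_simps)
    then show ?thesis using Dn by simp
  next
    case False
    have "D * (v / real n) \<le> 1"
      using mult_left_mono[OF v(2) D0] Ds by linarith
    then have "D \<le> real n / v"
      using False n by (simp add: field_simps)
    also have "\<dots> \<le> real n * (2 / (1 + v))"
      using False n by (simp add: field_simps)
    finally show ?thesis .
  qed
  \<comment> \<open>The relevant distance is the one around the circle, the smaller of
    \<open>u\<close> and \<open>n - u\<close>. Adding both weights in the conclusion spares the
    distinction afterwards.\<close>
  have "D \<le> real n * (2 / (1 + u)) \<or> D \<le> real n * (2 / (1 + (real n - u)))"
  proof (cases "u / real n \<le> 1/2")
    case True
    then have "u / real n \<le> \<bar>sin (pi * (u / real n))\<bar>"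
      using sin_pi_ge[of "u / real n"] u n by auto
    then show ?thesis using aux[of u] u by blast
  next
    case False
    then have "(real n - u) / real n \<le> sin (pi * ((real n - u) / real n))"
      using u n by (intro sin_pi_ge) (auto simp: field_simps)
    also have "pi * ((real n - u) / real n) = pi - pi * (u / real n)"
      using n by (simp add: field_simps)
    finally have "(real n - u) / real n \<le> \<bar>sin (pi * (u / real n))\<bar>"
      by simp
    then show ?thesis using aux[of "real n - u"] u by auto
  qed
  moreover have "0 \<le> real n * (2 / (1 + u))" "0 \<le> real n * (2 / (1 + (real n - u)))"
    using u by auto
  ultimately show ?thesis
    unfolding D_def[symmetric] by (auto simp: distrib_left add_diff_eq)
qed

lemma harm_eq_sum: "(\<Sum>i<n. 1 / real (Suc i)) = harm n"
  unfolding harm_def One_nat_def by (subst sum.atLeast1_atMost_eq) (simp add: inverse_eq_divide)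

text \<open>Cut at \<open>m = \<lfloor>t\<rfloor>\<close>. On either side the distances from
  \<open>t\<close>, measured both ways round the circle, are at least 0, 1, 2, ... in some order.
  This yields four partial harmonic sums, each with factor 2, hence the 8.\<close>

lemma kernel_weights_sum:
  fixes t :: real
  assumes t: "0 \<le> t" "t < real n"
  shows "(\<Sum>l<n. 2 / (1 + \<bar>t - real l\<bar>) + 2 / (1 + real n - \<bar>t - real l\<bar>)) \<le> 8 * harm n"
proof -
  define m where "m = nat \<lfloor>t\<rfloor>"
  have m: "real m \<le> t" "t < real m + 1"
    using t by (auto simp: m_def)
  then have mn: "m < n"
    using t by linarith
  define h where "h i = 1 / real (Suc i)" for i
  have h0: "h i \<ge> 0" for i
    by (simp add: h_def)
  have "2 / (1 + \<bar>t - real l\<bar>) + 2 / (1 + real n - \<bar>t - real l\<bar>) \<le> 2 * h (m - l) + 2 * h l" if "l < Suc m" for l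
  proof -
    have "2 / (1 + \<bar>t - real l\<bar>) \<le> 2 / real (Suc (m - l))"
      using m that by (intro divide_left_mono) (auto simp: of_nat_diff)
    moreover have "2 / (1 + real n - \<bar>t - real l\<bar>) \<le> 2 / real (Suc l)"
      using m mn that by (intro divide_left_mono) (auto intro!: mult_pos_pos)
    ultimately show ?thesis by (simp add: h_def)
  qed
  then have "(\<Sum>l<Suc m. 2 / (1 + \<bar>t - real l\<bar>) + 2 / (1 + real n - \<bar>t - real l\<bar>))
      \<le> (\<Sum>l<Suc m. 2 * h (m - l) + 2 * h l)"
    by (intro sum_mono) auto
  also have "\<dots> = 2 * (\<Sum>l<Suc m. h (Suc m - Suc l)) + 2 * (\<Sum>l<Suc m. h l)"
    by (simp add: sum.distrib sum_distrib_left del: sum.lessThan_Suc)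
  also have "\<dots> = 4 * (\<Sum>l<Suc m. h l)"
    by (subst sum.nat_diff_reindex) simp
  also have "\<dots> \<le> 4 * (\<Sum>l<n. h l)"
    using mn h0 by (intro mult_left_mono sum_mono2) auto
  finally have 1: "(\<Sum>l<Suc m. 2 / (1 + \<bar>t - real l\<bar>) + 2 / (1 + real n - \<bar>t - real l\<bar>)) \<le> 4 * (\<Sum>l<n. h l)" .
  have "2 / (1 + \<bar>t - real l\<bar>) + 2 / (1 + real n - \<bar>t - real l\<bar>) \<le> 2 * h (l - Suc m) + 2 * h (n - Suc l)"
    if "Suc m \<le> l" "l < n" for l
  proof -
    have "2 / (1 + \<bar>t - real l\<bar>) \<le> 2 / real (Suc (l - Suc m))"
      using m that by (intro divide_left_mono) (auto simp: of_nat_diff)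
    moreover have "2 / (1 + real n - \<bar>t - real l\<bar>) \<le> 2 / real (Suc (n - Suc l))"
      using m mn that by (intro divide_left_mono) (auto simp: of_nat_diff intro!: mult_pos_pos)
    ultimately show ?thesis by (simp add: h_def)
  qed
  then have "(\<Sum>l=Suc m..<n. 2 / (1 + \<bar>t - real l\<bar>) + 2 / (1 + real n - \<bar>t - real l\<bar>))
      \<le> (\<Sum>l=Suc m..<n. 2 * h (l - Suc m) + 2 * h (n - Suc l))"
    by (intro sum_mono) auto
  also have "\<dots> = 2 * (\<Sum>l=Suc m..<n. h (l - Suc m)) + 2 * (\<Sum>l=Suc m..<n. h (n - Suc l))"
    by (simp add: sum.distrib sum_distrib_left)
  also have "(\<Sum>l=Suc m..<n. h (l - Suc m)) = (\<Sum>l<n - Suc m. h l)"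
    by (rule sum.reindex_bij_witness[of _ "\<lambda>l. l + Suc m" "\<lambda>l. l - Suc m"]) auto
  also have "\<dots> \<le> (\<Sum>l<n. h l)"
    using h0 by (intro sum_mono2) auto
  also have "(\<Sum>l=Suc m..<n. h (n - Suc l)) \<le> (\<Sum>l<n. h (n - Suc l))"
    using h0 by (intro sum_mono2) auto
  also have "(\<Sum>l<n. h (n - Suc l)) = (\<Sum>l<n. h l)"
    by (rule sum.nat_diff_reindex)
  finally have 2: "(\<Sum>l=Suc m..<n. 2 / (1 + \<bar>t - real l\<bar>) + 2 / (1 + real n - \<bar>t - real l\<bar>)) \<le> 4 * (\<Sum>l<n. h l)"
    by simp
  have "(\<Sum>l<n. 2 / (1 + \<bar>t - real l\<bar>) + 2 / (1 + real n - \<bar>t - real l\<bar>))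
     = (\<Sum>l<Suc m. 2 / (1 + \<bar>t - real l\<bar>) + 2 / (1 + real n - \<bar>t - real l\<bar>))
     + (\<Sum>l=Suc m..<n. 2 / (1 + \<bar>t - real l\<bar>) + 2 / (1 + real n - \<bar>t - real l\<bar>))"
    unfolding lessThan_atLeast0 using mn by (intro sum.atLeastLessThan_concat[symmetric]) auto
  then show ?thesis
    using 1 2 harm_eq_sum[of n] by (simp add: h_def del: sum.lessThan_Suc)
qed

lemma partial_interpolation_bound:
  assumes n: "n > 0" and m: "m \<le> n" and th: "0 \<le> \<theta>" "\<theta> < 2 * pi"
    and F: "\<And>l. l < n \<Longrightarrow> norm (F (node n l)) \<le> 1"
  shows "norm (\<Sum>j<m. exp (\<i> * of_int (a + int j) * of_real \<theta>) * discrete_fourier n F (a + int j)) \<le> 8 * harm n"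
proof -
  define t where "t = \<theta> * real n / (2 * pi)"
  have t: "0 \<le> t" "t < real n"
    using th n by (auto simp: t_def field_simps)
  let ?D = "\<lambda>l. \<Sum>j<m. exp (\<i> * of_int (a + int j) * of_real (2 * pi * (t - real l) / real n))"
  have e: "exp (\<i> * of_int k * of_real \<theta>) * exp (- \<i> * of_int k * of_real (node n l))
      = exp (\<i> * of_int k * of_real (2 * pi * (t - real l) / real n))" for k l
    using n by (simp add: exp_add[symmetric] t_def node_def diff_divide_distrib algebra_simps)
  have "(\<Sum>j<m. exp (\<i> * of_int (a + int j) * of_real \<theta>) * discrete_fourier n F (a + int j))
      = (\<Sum>j<m. \<Sum>l<n. 1 / of_nat n * F (node n l) *
          (exp (\<i> * of_int (a + int j) * of_real \<theta>) * exp (- \<i> * of_int (a + int j) * of_real (node n l))))"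
    unfolding discrete_fourier_def sum_distrib_left by (simp only: mult_ac)
  also have "\<dots> = (\<Sum>l<n. 1 / of_nat n * F (node n l) * ?D l)"
    unfolding e by (subst sum.swap) (simp only: sum_distrib_left)
  finally have "norm (\<Sum>j<m. exp (\<i> * of_int (a + int j) * of_real \<theta>) * discrete_fourier n F (a + int j))
      \<le> (\<Sum>l<n. norm (1 / of_nat n * F (node n l) * ?D l))"
    by (simp only: norm_sum)
  also have "\<dots> \<le> (\<Sum>l<n. 2 / (1 + \<bar>t - real l\<bar>) + 2 / (1 + real n - \<bar>t - real l\<bar>))"
  proof (rule sum_mono)
    fix l assume "l \<in> {..<n}"
    then have l: "l < n" by simp
    have "norm (F (node n l)) * norm (?D l)
        \<le> 1 * (real n * (2 / (1 + \<bar>t - real l\<bar>) + 2 / (1 + real n - \<bar>t - real l\<bar>)))"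
      using F[OF l] kernel_bound[OF l t m, of a] by (intro mult_mono) auto
    then have "1 / real n * (norm (F (node n l)) * norm (?D l))
        \<le> 1 / real n * (real n * (2 / (1 + \<bar>t - real l\<bar>) + 2 / (1 + real n - \<bar>t - real l\<bar>)))"
      by (intro mult_left_mono) auto
    also have "\<dots> = 2 / (1 + \<bar>t - real l\<bar>) + 2 / (1 + real n - \<bar>t - real l\<bar>)"
      using n by simp
    finally show "norm (1 / of_nat n * F (node n l) * ?D l) \<le> 2 / (1 + \<bar>t - real l\<bar>) + 2 / (1 + real n - \<bar>t - real l\<bar>)"
      by (simp add: norm_mult norm_divide)
  qed
  also have "\<dots> \<le> 8 * harm n"
    by (rule kernel_weights_sum[OF t])
  finally show ?thesis .
qed

lemma norm_discrete_fourier_le: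
  assumes F: "\<And>l. l < n \<Longrightarrow> norm (F (node n l)) \<le> 1"
  shows "norm (discrete_fourier n F k) \<le> 1"
proof -
  have "norm (\<Sum>l<n. exp (- \<i> * of_int k * of_real (node n l)) * F (node n l)) \<le> (\<Sum>l<n. 1)"
    using F by (intro sum_norm_le) (simp add: norm_mult norm_exp_eq_Re)
  then show ?thesis
    unfolding discrete_fourier_def by (cases "n = 0") (auto simp: norm_mult norm_divide field_simps)
qed

text \<open>Over \<open>n\<close> consecutive frequencies the sum is the interpolant at the node 0.
  Powers of a nontrivial n-th root of unity sum to zero over a full period, and the sample at
  \<open>l = 0\<close> is \<open>F 0\<close>.\<close>

lemma sum_discrete_fourier:
  assumes n: "n > 0" and F: "F 0 = 0"
  shows "(\<Sum>j<n. discrete_fourier n F (a + int j)) = 0"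
proof -
  have z: "F (node n l) * (\<Sum>j<n. exp (\<i> * of_int (a + int j) * of_real (- node n l))) = 0" if l: "l < n" for l
  proof (cases "l = 0")
    case True
    then show ?thesis using F by (simp add: node_def)
  next
    case False
    have nd: "0 < node n l" "node n l < 2 * pi"
      using False l by (auto simp: node_def field_simps)
    let ?w = "exp (\<i> * complex_of_real (- node n l))"
    have w1: "?w \<noteq> 1"
      using exp_ne_1[OF nd] by (simp add: exp_minus)
    have "?w ^ n = exp (\<i> * of_real (real n * (- node n l)))"
      by (simp add: exp_of_nat_mult[symmetric] mult_ac)
    also have "\<dots> = exp ((2 * of_int (- int l) * of_real pi) * \<i>)"
      using n by (simp add: node_def mult_ac)
    also have "\<dots> = 1"
      using exp_integer_2pi[of "of_int (- int l)"] by simp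
    finally have "(\<Sum>j<n. ?w ^ j) = 0"
      using w1 by (simp only: sum_gp_strict) simp
    then have "(\<Sum>j<n. exp (\<i> * of_int (a + int j) * of_real (- node n l))) = 0"
      unfolding iexp_int_add sum_distrib_left[symmetric] by simp
    then show ?thesis by simp
  qed
  have "(\<Sum>j<n. discrete_fourier n F (a + int j))
      = (\<Sum>j<n. \<Sum>l<n. 1 / of_nat n * (F (node n l) * exp (\<i> * of_int (a + int j) * of_real (- node n l))))"
    unfolding discrete_fourier_def sum_distrib_left by (simp add: mult_ac)
  also have "\<dots> = (\<Sum>l<n. 1 / of_nat n * (F (node n l) * (\<Sum>j<n. exp (\<i> * of_int (a + int j) * of_real (- node n l)))))"
    by (subst sum.swap) (simp only: sum_distrib_left)
  also have "\<dots> = 0"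
    by (rule sum.neutral) (auto simp only: z lessThan_iff mult_zero_right)
  finally show ?thesis .
qed

lemma abel_summation:
  fixes c :: "nat \<Rightarrow> complex"
  shows "(\<Sum>j<n. c j * w ^ j) = (\<Sum>i<n. c i) * w ^ n + (\<Sum>j<n. (\<Sum>i<Suc j. c i) * (w ^ j * (1 - w)))"
  by (induction n) (simp_all add: algebra_simps)

lemma harm_le_ln:
  assumes "n \<ge> 2"
  shows "harm n \<le> (1 + 1 / ln 2) * ln (real n)"
proof -
  have "harm n \<le> 1 + ln (real n)"
    using euler_mascheroni_sequence_decreasing[of 1 n] assms by (simp add: harm_expand)
  \<comment> \<open>From \<open>n \<ge> 2\<close> on, a multiple of the logarithm absorbs the
    additive 1.\<close>
  also have "1 \<le> 1 / ln 2 * ln (real n)"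
    using assms by (simp add: field_simps)
  finally show ?thesis
    by (simp add: algebra_simps)
qed

section \<open>The interpolation operator on the line\<close>

text \<open>The derivative of the angle \<open>\<theta>\<close> with respect to \<open>x\<close>, so
  the pullback of arc length on the circle; hence the total mass 2 pi.\<close>

definition circle_weight :: "real \<Rightarrow> real \<Rightarrow> real" where
  "circle_weight \<beta> x = 2 * \<beta> / (x\<^sup>2 + \<beta>\<^sup>2)"

lemma circle_weight_nonneg: "\<beta> > 0 \<Longrightarrow> 0 \<le> circle_weight \<beta> x"
  by (simp add: circle_weight_def)

lemma circle_weight_le: "\<beta> > 0 \<Longrightarrow> circle_weight \<beta> x \<le> 2 / \<beta>"
  by (simp add: circle_weight_def power2_eq_square divide_simps add_nonneg_pos)

lemma circle_weight_integral:
  assumes \<beta>: "\<beta> > 0"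
  shows "integrable lborel (circle_weight \<beta>)" "(\<integral>x. circle_weight \<beta> x \<partial>lborel) = 2 * pi"
proof -
  have e: "circle_weight \<beta> (0 + \<beta> * y) = 2 / \<beta> * inverse (1 + y\<^sup>2)" for y
  proof -
    have "(\<beta> * y)\<^sup>2 + \<beta>\<^sup>2 = \<beta>\<^sup>2 * (1 + y\<^sup>2)"
      by (simp add: power_mult_distrib distrib_left)
    then show ?thesis
      using \<beta> by (simp add: circle_weight_def power2_eq_square[of \<beta>] inverse_eq_divide)
  qed
  have "integrable lborel (\<lambda>y. circle_weight \<beta> (0 + \<beta> * y))"
    unfolding e using integrable_inverse_1_plus_square_UNIV(1) by simp
  then show "integrable lborel (circle_weight \<beta>)"
    using \<beta> lborel_integrable_real_affine_iff[of \<beta> "circle_weight \<beta>" 0] by simp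
  have "(\<integral>x. circle_weight \<beta> x \<partial>lborel) = \<bar>\<beta>\<bar> *\<^sub>R (\<integral>y. circle_weight \<beta> (0 + \<beta> * y) \<partial>lborel)"
    using \<beta> by (intro lborel_integral_real_affine) simp
  also have "\<dots> = 2 * pi"
    unfolding e using \<beta> integrable_inverse_1_plus_square_UNIV(2) by simp
  finally show "(\<integral>x. circle_weight \<beta> x \<partial>lborel) = 2 * pi" .
qed

text \<open>This converts decay like |1 - M| into square integrability: the integral of the square
  is 4 pi \<beta>.\<close>

lemma norm_one_minus_moebius:
  assumes \<beta>: "\<beta> > 0"
  shows "(norm (1 - moebius_map \<beta> (of_real x)))\<^sup>2 = 2 * \<beta> * circle_weight \<beta> x"
proof -
  have "norm (1 - moebius_map \<beta> (of_real x)) = 2 * \<beta> / norm (of_real \<beta> - \<i> * complex_of_real x)"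
    using \<beta> by (simp add: moebius_line[OF \<beta>] norm_divide norm_mult)
  moreover have "(norm (of_real \<beta> - \<i> * complex_of_real x))\<^sup>2 = x\<^sup>2 + \<beta>\<^sup>2"
    by (simp add: cmod_power2)
  ultimately show ?thesis
    by (simp add: circle_weight_def power_divide power_mult_distrib power2_eq_square[of \<beta>])
qed

lemma moebius_powi_tendsto:
  assumes \<beta>: "\<beta> > 0"
  shows "((\<lambda>x. moebius_map \<beta> (of_real x) powi p) \<longlongrightarrow> 1) at_infinity"
proof -
  have "((\<lambda>x::real. 2 * \<beta> * norm (inverse x)) \<longlongrightarrow> 2 * \<beta> * norm (0::real)) at_infinity"
    by (intro tendsto_intros tendsto_inverse_0)
  then have lim: "((\<lambda>x::real. 2 * \<beta> * norm (inverse x)) \<longlongrightarrow> 0) at_infinity"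
    by simp
  have "((\<lambda>x. moebius_map \<beta> (of_real x) - 1) \<longlongrightarrow> 0) at_infinity"
  proof (rule Lim_null_comparison[OF _ lim])
    show "\<forall>\<^sub>F x in at_infinity. norm (moebius_map \<beta> (of_real x) - 1) \<le> 2 * \<beta> * norm (inverse x)"
    proof (rule eventually_at_infinityI)
      fix x :: real assume "1 \<le> norm x"
      then have "x \<noteq> 0" by auto
      have "\<bar>x\<bar> \<le> norm (of_real \<beta> - \<i> * complex_of_real x)"
        using abs_Im_le_cmod[of "of_real \<beta> - \<i> * complex_of_real x"] by simp
      moreover have "norm (moebius_map \<beta> (of_real x) - 1) = 2 * \<beta> / norm (of_real \<beta> - \<i> * complex_of_real x)"
        using \<beta> by (simp add: moebius_line[OF \<beta>] norm_divide norm_mult)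
      ultimately show "norm (moebius_map \<beta> (of_real x) - 1) \<le> 2 * \<beta> * norm (inverse x)"
        using \<open>x \<noteq> 0\<close> \<beta> frac_le[of "2 * \<beta>" "2 * \<beta>" "\<bar>x\<bar>"] by (simp add: divide_inverse)
    qed
  qed
  then have "((\<lambda>x. moebius_map \<beta> (of_real x)) \<longlongrightarrow> 1) at_infinity"
    by (simp add: LIM_zero_iff)
  then show ?thesis
    using tendsto_power_int[of "\<lambda>x. moebius_map \<beta> (of_real x)" 1 at_infinity p] by simp
qed

lemma moebius_powi_deriv:
  assumes \<beta>: "\<beta> > 0"
  shows "((\<lambda>x. moebius_map \<beta> (of_real x) powi p) has_vector_derivative
    \<i> * of_int p * (of_real (circle_weight \<beta> x) * moebius_map \<beta> (of_real x) powi p)) (at x)"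
proof (rule has_vector_derivative_real_field)
  let ?z = "complex_of_real x" and ?b = "\<i> * complex_of_real \<beta>"
  have nz: "?z + ?b \<noteq> 0" "?z - ?b \<noteq> 0"
    using \<beta> by (auto simp: complex_eq_iff)
  have M0: "moebius_map \<beta> ?z \<noteq> 0"
    by (rule moebius_line_nonzero[OF \<beta>])
  have "(moebius_map \<beta> has_field_derivative 2 * ?b / (?z + ?b)\<^sup>2) (at ?z)"
    unfolding moebius_map_def[abs_def] using nz
    by (auto intro!: derivative_eq_intros simp: power2_eq_square)
  then have "((\<lambda>z. moebius_map \<beta> z powi p) has_field_derivative
      of_int p * moebius_map \<beta> ?z powi (p - 1) * (2 * ?b / (?z + ?b)\<^sup>2)) (at ?z)"
    using M0 by (auto intro!: derivative_eq_intros)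
  also have "of_int p * moebius_map \<beta> ?z powi (p - 1) * (2 * ?b / (?z + ?b)\<^sup>2)
      = \<i> * of_int p * (of_real (circle_weight \<beta> x) * moebius_map \<beta> ?z powi p)"
  proof -
    have w: "of_real (circle_weight \<beta> x) = 2 * of_real \<beta> / ((?z + ?b) * (?z - ?b))"
      by (simp add: circle_weight_def power2_eq_square algebra_simps)
    have "2 * ?b / (?z + ?b)\<^sup>2 = \<i> * of_real (circle_weight \<beta> x) * moebius_map \<beta> ?z"
      unfolding w moebius_map_def using nz by (simp add: divide_simps power2_eq_square)
    then show ?thesis
      using power_int_minus_mult[of "moebius_map \<beta> ?z" p] M0 by (simp add: mult_ac)
  qed
  finally show "((\<lambda>z. moebius_map \<beta> z powi p) has_field_derivative
      \<i> * of_int p * (of_real (circle_weight \<beta> x) * moebius_map \<beta> ?z powi p)) (at ?z)" .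
qed

lemma moebius_powi_isCont:
  assumes "\<beta> > 0"
  shows "isCont (\<lambda>x. moebius_map \<beta> (of_real x) powi p) x"
  using moebius_powi_deriv[OF assms] by (rule has_vector_derivative_continuous)

lemma norm_moebius_powi: "\<beta> > 0 \<Longrightarrow> norm (moebius_map \<beta> (of_real x) powi p) = 1"
  by (simp add: norm_power_int norm_moebius_line)

text \<open>For nonzero \<open>p\<close> the integrand is the derivative of
  \<open>M powi p / (\<i> * p)\<close>, whose limits at both ends of the line agree.\<close>

lemma moebius_powi_integral:
  assumes \<beta>: "\<beta> > 0"
  shows "integrable lborel (\<lambda>x. of_real (circle_weight \<beta> x) * moebius_map \<beta> (of_real x) powi p)"
    and "(\<integral>x. of_real (circle_weight \<beta> x) * moebius_map \<beta> (of_real x) powi p \<partial>lborel)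
      = (if p = 0 then 2 * pi else 0)"
proof -
  let ?f = "\<lambda>x. of_real (circle_weight \<beta> x) * moebius_map \<beta> (of_real x) powi p"
  have wc: "isCont (\<lambda>x. complex_of_real (circle_weight \<beta> x)) x" for x
    unfolding circle_weight_def using \<beta>
    by (intro continuous_intros) (auto simp: add_nonneg_eq_0_iff)
  have fc: "isCont ?f x" for x
    by (intro continuous_intros wc moebius_powi_isCont[OF \<beta>])
  show int: "integrable lborel ?f"
  proof (rule Bochner_Integration.integrable_bound[OF circle_weight_integral(1)[OF \<beta>]])
    show "?f \<in> borel_measurable lborel"
      using fc by (simp add: borel_measurable_continuous_onI continuous_at_imp_continuous_on)
  qed (simp add: norm_mult norm_moebius_powi[OF \<beta>])
  show "(\<integral>x. ?f x \<partial>lborel) = (if p = 0 then 2 * pi else 0)"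
  proof (cases "p = 0")
    case True
    then show ?thesis
      using circle_weight_integral(2)[OF \<beta>] by simp
  next
    case False
    let ?F = "\<lambda>x. inverse (\<i> * of_int p) * moebius_map \<beta> (of_real x) powi p"
    have lim: "(?F \<longlongrightarrow> inverse (\<i> * of_int p) * 1) F" if "F \<le> at_infinity" for F
      by (intro tendsto_mult tendsto_const tendsto_mono[OF that] moebius_powi_tendsto[OF \<beta>])
    have "(LBINT x=-\<infinity>..\<infinity>. ?f x) = inverse (\<i> * of_int p) * 1 - inverse (\<i> * of_int p) * 1"
    proof (rule interval_integral_FTC_integrable[where F = ?F])
      have "inverse (\<i> * of_int p) * (\<i> * of_int p * z) = z" for z
        using False by (simp add: field_simps)
      then show "(?F has_vector_derivative ?f x) (at x)" for x
        using has_vector_derivative_mult_right[OF moebius_powi_deriv[OF \<beta>], of "inverse (\<i> * of_int p)" p x]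
        by (simp only:)
      show "isCont ?f x" for x
        by (rule fc)
      show "set_integrable lborel (einterval (-\<infinity>) \<infinity>) ?f"
        using int by (simp add: set_integrable_def einterval_def)
      show "((?F \<circ> real_of_ereal) \<longlongrightarrow> inverse (\<i> * of_int p) * 1) (at_right (- \<infinity>))"
        unfolding ereal_tendsto_simps by (rule lim[OF at_bot_le_at_infinity])
      show "((?F \<circ> real_of_ereal) \<longlongrightarrow> inverse (\<i> * of_int p) * 1) (at_left \<infinity>)"
        unfolding ereal_tendsto_simps by (rule lim[OF at_top_le_at_infinity])
    qed auto
    then show ?thesis
      using False by (simp add: interval_lebesgue_integral_def set_lebesgue_integral_def einterval_def)
  qed
qed

text \<open>Conjugation inverts \<open>M\<close> on the line, so the pair of indices
  \<open>j\<close>, \<open>l\<close> contributes the power \<open>j - l\<close> and the common shift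
  \<open>a\<close> cancels.\<close>

lemma moebius_parseval:
  assumes \<beta>: "\<beta> > 0"
  shows "integrable lborel (\<lambda>x. circle_weight \<beta> x *
      (norm (\<Sum>j<n. d j * moebius_map \<beta> (of_real x) powi (a + int j)))\<^sup>2)" (is "integrable _ ?g")
    and "(\<integral>x. circle_weight \<beta> x *
      (norm (\<Sum>j<n. d j * moebius_map \<beta> (of_real x) powi (a + int j)))\<^sup>2 \<partial>lborel) = 2 * pi * (\<Sum>j<n. (norm (d j))\<^sup>2)"
proof -
  let ?M = "\<lambda>x. moebius_map \<beta> (complex_of_real x)"
  have cM: "cnj (?M x) = inverse (?M x)" for x
    using norm_moebius_line[OF \<beta>, of x]
    by (metis complex_norm_square inverse_unique mult.commute of_real_1 one_power2)
  have eq: "complex_of_real (?g x) = (\<Sum>j<n. \<Sum>l<n. d j * cnj (d l) *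
      (of_real (circle_weight \<beta> x) * ?M x powi (int j - int l)))" for x
  proof -
    have m: "?M x powi (a + int j) * cnj (?M x powi (a + int l)) = ?M x powi (int j - int l)" for j l
    proof -
      have M0: "?M x \<noteq> 0"
        by (rule moebius_line_nonzero[OF \<beta>])
      have "cnj (?M x powi (a + int l)) = ?M x powi (- (a + int l))"
        by (simp only: complex_cnj_power_int cM power_int_inverse power_int_minus)
      then have "?M x powi (a + int j) * cnj (?M x powi (a + int l)) = ?M x powi ((a + int j) + - (a + int l))"
        by (simp only: power_int_add[OF disjI1[OF M0]])
      then show ?thesis
        by simp
    qed
    have "complex_of_real (?g x) = of_real (circle_weight \<beta> x) *
        ((\<Sum>j<n. d j * ?M x powi (a + int j)) * cnj (\<Sum>j<n. d j * ?M x powi (a + int j)))"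
      unfolding of_real_mult complex_norm_square ..
    also have "\<dots> = (\<Sum>j<n. \<Sum>l<n. d j * cnj (d l) *
        (of_real (circle_weight \<beta> x) * (?M x powi (a + int j) * cnj (?M x powi (a + int l)))))"
      unfolding cnj_sum sum_product complex_cnj_mult unfolding sum_distrib_left
      by (intro sum.cong refl) (simp only: mult_ac)
    finally show ?thesis
      unfolding m .
  qed
  have i: "integrable lborel (\<lambda>x. \<Sum>j<n. \<Sum>l<n. d j * cnj (d l) *
      (of_real (circle_weight \<beta> x) * ?M x powi (int j - int l)))"
    by (intro Bochner_Integration.integrable_sum integrable_mult_right moebius_powi_integral(1)[OF \<beta>])
  then have "integrable lborel (\<lambda>x. complex_of_real (?g x))"
    unfolding eq .
  then show "integrable lborel ?g"
    by (simp only: complex_of_real_integrable_eq)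
  have "complex_of_real (\<integral>x. ?g x \<partial>lborel) = (\<integral>x. complex_of_real (?g x) \<partial>lborel)"
    by (rule integral_complex_of_real[symmetric])
  also have "\<dots> = (\<Sum>j<n. \<Sum>l<n. d j * cnj (d l) * (if int j - int l = 0 then 2 * pi else 0))"
    unfolding eq
    by (simp add: Bochner_Integration.integral_sum moebius_powi_integral[OF \<beta>] integrable_mult_right
        Bochner_Integration.integrable_sum del: of_real_divide)
  also have "\<dots> = (\<Sum>j<n. \<Sum>l<n. if j = l then 2 * pi * (d j * cnj (d l)) else 0)"
    by (intro sum.cong refl) auto
  also have "\<dots> = (\<Sum>j<n. 2 * pi * (d j * cnj (d j)))"
    by (simp add: sum.delta')
  also have "\<dots> = complex_of_real (2 * pi * (\<Sum>j<n. (norm (d j))\<^sup>2))"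
    by (simp only: complex_norm_square[symmetric] sum_distrib_left[symmetric] of_real_sum of_real_mult)
  finally show "(\<integral>x. ?g x \<partial>lborel) = 2 * pi * (\<Sum>j<n. (norm (d j))\<^sup>2)"
    by (simp only: of_real_eq_iff)
qed

lemma sum_symmetric_frequencies:
  assumes n: "n > 0"
  shows "(\<Sum>k = - int ((n - 1) div 2)..int (n div 2). g k) = (\<Sum>j<n. g (- int ((n - 1) div 2) + int j))"
proof (rule sum.reindex_bij_witness[of _ "\<lambda>j. - int ((n - 1) div 2) + int j" "\<lambda>k. nat (k + int ((n - 1) div 2))"])
  \<comment> \<open>Whatever the parity of \<open>n\<close>, the range contains exactly
    \<open>n\<close> consecutive frequencies.\<close>
  have "(n - 1) div 2 + n div 2 = n - 1"
    using n by presburger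
  then have e: "int ((n - 1) div 2) + int (n div 2) = int n - 1"
    using n by linarith
  show "nat (k + int ((n - 1) div 2)) \<in> {..<n}" if "k \<in> {- int ((n - 1) div 2)..int (n div 2)}" for k
  proof -
    have "k + int ((n - 1) div 2) < int n"
      using that e by (simp only: atLeastAtMost_iff) linarith
    then show ?thesis
      using n by simp
  qed
  show "- int ((n - 1) div 2) + int j \<in> {- int ((n - 1) div 2)..int (n div 2)}" if "j \<in> {..<n}" for j
    using that e by (simp only: atLeastAtMost_iff lessThan_iff) linarith
qed auto

section \<open>Estimates for a single interpolant\<close>

context
  fixes \<beta> :: real and n :: nat and f :: "real \<Rightarrow> complex"
  assumes \<beta>: "\<beta> > 0" and n: "n > 0"
begin

private abbreviation "M \<equiv> \<lambda>x. moebius_map \<beta> (complex_of_real x)"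
private abbreviation "a \<equiv> - int ((n - 1) div 2)"
private abbreviation "c \<equiv> \<lambda>j. discrete_fourier n (lift_to_circle \<beta> f) (a + int j)"

lemma interp_op_sum: "interp_op \<beta> n f x = (\<Sum>j<n. c j * M x powi (a + int j))"
  unfolding interp_op_eq[OF \<beta>] by (rule sum_symmetric_frequencies[OF n])

lemma sum_coeffs_zero: "(\<Sum>j<n. c j) = 0"
  by (rule sum_discrete_fourier[OF n]) (simp add: lift_to_circle_def)

text \<open>Replacing each power \<open>M powi k\<close> by \<open>M powi k - 1\<close> is free
  because the coefficients sum to 0. As only finitely many samples of \<open>f\<close> enter, this
  yields the mapping properties on the whole space and not just on a unit ball.\<close>

lemma fourier_pair_interp_op: "\<exists>u. fourier_pair u (interp_op \<beta> n f)"
proof -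
  have "interp_op \<beta> n f = (\<lambda>x. \<Sum>j<n. c j * (M x powi (a + int j) - 1))"
    using sum_coeffs_zero by (simp add: interp_op_sum fun_eq_iff right_diff_distrib sum_subtractf)
  moreover have "\<exists>u. fourier_pair u (\<lambda>x. \<Sum>j<n. c j * (M x powi (a + int j) - 1))"
  proof (rule fourier_pair_sum)
    fix j
    obtain u where "fourier_pair u (\<lambda>x. M x powi (a + int j) - 1)"
      using fourier_pair_moebius_powi[OF \<beta>] by blast
    then show "\<exists>u. fourier_pair u (\<lambda>x. c j * (M x powi (a + int j) - 1))"
      using fourier_pair_mult by blast
  qed simp
  ultimately show ?thesis
    by simp
qed

lemma interp_op_C0: "interp_op \<beta> n f \<in> C0_space"
proof -
  have "((\<lambda>x. \<Sum>j<n. c j * M x powi (a + int j)) \<longlongrightarrow> (\<Sum>j<n. c j * 1)) at_infinity"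
    by (intro tendsto_sum tendsto_mult tendsto_const moebius_powi_tendsto[OF \<beta>])
  then have "(interp_op \<beta> n f \<longlongrightarrow> 0) at_infinity"
    using sum_coeffs_zero by (simp add: interp_op_sum[abs_def])
  moreover have "continuous_on UNIV (interp_op \<beta> n f)"
    using fourier_pair_interp_op fourier_pair_measurable(3) by blast
  ultimately show ?thesis
    by (simp add: C0_space_def)
qed

lemma interp_op_deriv:
  "(interp_op \<beta> n f has_vector_derivative
     (\<Sum>j<n. c j * (\<i> * of_int (a + int j) * (of_real (circle_weight \<beta> x) * M x powi (a + int j))))) (at x)"
  unfolding interp_op_sum[abs_def]
  by (intro has_vector_derivative_sum has_vector_derivative_mult_right moebius_powi_deriv[OF \<beta>])

context
  assumes f: "\<And>x. norm (f x) \<le> 1"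
begin

lemma norm_lift_le: "norm (lift_to_circle \<beta> f \<theta>) \<le> 1"
  using f by (simp add: lift_to_circle_def)

lemma norm_interp_op_le: "norm (interp_op \<beta> n f x) \<le> 8 * harm n"
proof -
  have "x \<in> circle_to_line \<beta> ` {0<..<2*pi}" "inj_on (circle_to_line \<beta>) {0<..<2*pi}"
    using bij_betw_circle_to_line[OF \<beta>] by (auto simp: bij_betw_def)
  then have "line_to_circle \<beta> x \<in> {0<..<2*pi}"
    unfolding line_to_circle_def by (intro the_inv_into_into) auto
  then have "norm (\<Sum>j<n. exp (\<i> * of_int (a + int j) * of_real (line_to_circle \<beta> x)) * c j) \<le> 8 * harm n"
    by (intro partial_interpolation_bound n norm_lift_le) auto
  then show ?thesis
    unfolding interp_op_def trig_interp_def sum_symmetric_frequencies[OF n] .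
qed

text \<open>As the coefficients sum to \<open>0\<close>, summation by parts splits off the factor \<open>1 - M x\<close>; the remaining
  coefficients are partial sums of the interpolant at \<open>\<theta> = 0\<close>, hence bounded like the Lebesgue constant.\<close>

lemma interp_op_decay: "norm (interp_op \<beta> n f x) \<le> real n * (8 * harm n) * norm (1 - M x)"
proof -
  have M0: "M x \<noteq> 0"
    by (rule moebius_line_nonzero[OF \<beta>])
  \<comment> \<open>The factor \<open>M x powi a\<close> has modulus 1; splitting it off leaves
    nonnegative exponents for Abel summation.\<close>
  have "interp_op \<beta> n f x = M x powi a * (\<Sum>j<n. c j * M x ^ j)"
    unfolding interp_op_sum sum_distrib_left
    by (intro sum.cong refl) (simp only: power_int_add[OF disjI1[OF M0]] power_int_of_nat mult_ac)
  also have "(\<Sum>j<n. c j * M x ^ j) = (\<Sum>j<n. (\<Sum>i<Suc j. c i) * (M x ^ j * (1 - M x)))"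
    using sum_coeffs_zero by (subst abel_summation) simp
  finally have "norm (interp_op \<beta> n f x) = norm (\<Sum>j<n. (\<Sum>i<Suc j. c i) * (M x ^ j * (1 - M x)))"
    by (simp add: norm_mult norm_moebius_powi[OF \<beta>] del: sum.lessThan_Suc)
  also have "\<dots> \<le> (\<Sum>j<n. 8 * harm n * norm (1 - M x))"
  proof (rule sum_norm_le)
    fix j assume "j \<in> {..<n}"
    then have "norm (\<Sum>i<Suc j. exp (\<i> * of_int (a + int i) * of_real 0) * c i) \<le> 8 * harm n"
      by (intro partial_interpolation_bound n norm_lift_le) auto
    then have "norm (\<Sum>i<Suc j. c i) * norm (1 - M x) \<le> 8 * harm n * norm (1 - M x)"
      by (intro mult_right_mono) (auto simp del: sum.lessThan_Suc)
    then show "norm ((\<Sum>i<Suc j. c i) * (M x ^ j * (1 - M x))) \<le> 8 * harm n * norm (1 - M x)"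
      by (simp add: norm_mult norm_power norm_moebius_line[OF \<beta>] del: sum.lessThan_Suc)
  qed
  finally show ?thesis
    by simp
qed

lemma interp_op_L2: "(\<integral>x. (norm (interp_op \<beta> n f x))\<^sup>2 \<partial>lborel) \<le> (real n * (8 * harm n))\<^sup>2 * (4 * pi * \<beta>)"
proof -
  have "(norm (interp_op \<beta> n f x))\<^sup>2 \<le> (real n * (8 * harm n))\<^sup>2 * (2 * \<beta> * circle_weight \<beta> x)" for x
    using power_mono[OF interp_op_decay norm_ge_zero, of x 2]
    by (simp add: power_mult_distrib norm_one_minus_moebius[OF \<beta>] mult_ac)
  then have "(\<integral>x. (norm (interp_op \<beta> n f x))\<^sup>2 \<partial>lborel)
      \<le> (\<integral>x. (real n * (8 * harm n))\<^sup>2 * (2 * \<beta> * circle_weight \<beta> x) \<partial>lborel)"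
    using \<beta> circle_weight_integral(1)[OF \<beta>] circle_weight_nonneg[OF \<beta>]
    by (intro integral_mono') auto
  also have "\<dots> = (real n * (8 * harm n))\<^sup>2 * (4 * pi * \<beta>)"
    using circle_weight_integral(2)[OF \<beta>] by simp
  finally show ?thesis .
qed

text \<open>Of the two weights in |h'|^2 one is bounded by \<open>2 / \<beta>\<close> and the other
  is kept for Parseval. The coefficients \<open>d j\<close> are at most \<open>n\<close> in modulus,
  so their squares sum to at most n^3.\<close>

lemma interp_op_deriv_L2:
  "(\<integral>x. (norm (\<Sum>j<n. c j * (\<i> * of_int (a + int j) * (of_real (circle_weight \<beta> x) * M x powi (a + int j)))))\<^sup>2 \<partial>lborel)
     \<le> 4 * pi / \<beta> * real n ^ 3"
proof -
  define d where "d j = c j * of_int (a + int j)" for j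
  let ?S = "\<lambda>x. \<Sum>j<n. d j * M x powi (a + int j)"
  have "(norm (\<Sum>j<n. c j * (\<i> * of_int (a + int j) * (of_real (circle_weight \<beta> x) * M x powi (a + int j)))))\<^sup>2
      \<le> 2 / \<beta> * (circle_weight \<beta> x * (norm (?S x))\<^sup>2)" for x
  proof -
    have "(\<Sum>j<n. c j * (\<i> * of_int (a + int j) * (of_real (circle_weight \<beta> x) * M x powi (a + int j))))
        = \<i> * of_real (circle_weight \<beta> x) * ?S x"
      unfolding sum_distrib_left d_def by (intro sum.cong refl) (simp only: mult_ac)
    then have "(norm (\<Sum>j<n. c j * (\<i> * of_int (a + int j) * (of_real (circle_weight \<beta> x) * M x powi (a + int j)))))\<^sup>2
        = circle_weight \<beta> x * (circle_weight \<beta> x * (norm (?S x))\<^sup>2)"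
      using circle_weight_nonneg[OF \<beta>, of x] by (simp add: norm_mult power_mult_distrib power2_eq_square[of "circle_weight _ _"])
    also have "\<dots> \<le> 2 / \<beta> * (circle_weight \<beta> x * (norm (?S x))\<^sup>2)"
      using circle_weight_nonneg[OF \<beta>, of x] circle_weight_le[OF \<beta>, of x] by (intro mult_right_mono) auto
    finally show ?thesis .
  qed
  then have "(\<integral>x. (norm (\<Sum>j<n. c j * (\<i> * of_int (a + int j) * (of_real (circle_weight \<beta> x) * M x powi (a + int j)))))\<^sup>2 \<partial>lborel)
      \<le> (\<integral>x. 2 / \<beta> * (circle_weight \<beta> x * (norm (?S x))\<^sup>2) \<partial>lborel)"
    using \<beta> circle_weight_nonneg[OF \<beta>]
    by (intro integral_mono' integrable_mult_right moebius_parseval(1)[OF \<beta>]) auto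
  also have "\<dots> = 2 / \<beta> * (2 * pi * (\<Sum>j<n. (norm (d j))\<^sup>2))"
    unfolding integral_mult_right_zero moebius_parseval(2)[OF \<beta>] ..
  also have "\<dots> \<le> 2 / \<beta> * (2 * pi * (\<Sum>j<n. (real n)\<^sup>2))"
  proof (intro mult_left_mono sum_mono power_mono)
    fix j assume "j \<in> {..<n}"
    then have "\<bar>a + int j\<bar> \<le> int n"
      by (auto simp: abs_le_iff)
    then have "\<bar>real_of_int (a + int j)\<bar> \<le> real n"
      by linarith
    then have "norm (c j) * \<bar>real_of_int (a + int j)\<bar> \<le> 1 * real n"
      by (intro mult_mono norm_discrete_fourier_le norm_lift_le) auto
    then show "norm (d j) \<le> real n"
      unfolding d_def norm_mult norm_of_int by simp
  qed (use \<beta> in auto)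
  also have "\<dots> = 4 * pi / \<beta> * real n ^ 3"
    by (simp add: power2_eq_square power3_eq_cube)
  finally show ?thesis .
qed

lemma interp_op_H1:
  "interp_op \<beta> n f \<in> H1_space"
  "H1_norm (interp_op \<beta> n f) \<le> sqrt (4 * pi * ((real n * (8 * harm n))\<^sup>2 * (4 * pi * \<beta>) + 4 * pi / \<beta> * real n ^ 3))"
proof -
  obtain u where u: "fourier_pair u (interp_op \<beta> n f)"
    using fourier_pair_interp_op by blast
  show "interp_op \<beta> n f \<in> H1_space"
    by (rule fourier_pair_H1(1)[OF u interp_op_deriv])
  show "H1_norm (interp_op \<beta> n f) \<le> sqrt (4 * pi * ((real n * (8 * harm n))\<^sup>2 * (4 * pi * \<beta>) + 4 * pi / \<beta> * real n ^ 3))"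
    by (rule order_trans[OF fourier_pair_H1(2)[OF u interp_op_deriv]])
       (intro real_sqrt_le_mono mult_left_mono add_mono interp_op_L2 interp_op_deriv_L2, simp)
qed

end

end

section \<open>From pointwise bounds to operator norms\<close>

lemma sup_norm_le_1_imp_norm_le_1:
  assumes f: "f \<in> C0_space" and le: "sup_norm f \<le> 1"
  shows "norm (f x) \<le> 1"
proof -
  have c: "continuous_on UNIV f" and l: "(f \<longlongrightarrow> 0) at_infinity"
    using f by (auto simp: C0_space_def)
  have "\<forall>\<^sub>F y in at_infinity. norm (f y) < 1"
    using tendstoD[OF l, of 1] by simp
  then obtain b where b: "\<And>y. b \<le> norm y \<Longrightarrow> norm (f y) < 1"
    by (auto simp: eventually_at_infinity)
  have "compact (f ` {-\<bar>b\<bar>..\<bar>b\<bar>})"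
    by (intro compact_continuous_image continuous_on_subset[OF c]) auto
  then obtain B where B: "\<forall>z\<in>f ` {-\<bar>b\<bar>..\<bar>b\<bar>}. norm z \<le> B"
    using compact_imp_bounded[of "f ` {-\<bar>b\<bar>..\<bar>b\<bar>}"] by (auto simp: bounded_iff)
  have "norm (f y) \<le> max 1 B" for y
  proof (cases "b \<le> norm y")
    case True
    then show ?thesis using b[of y] by simp
  next
    case False
    then have "y \<in> {-\<bar>b\<bar>..\<bar>b\<bar>}" by auto
    then show ?thesis using B by (simp add: le_max_iff_disj)
  qed
  \<comment> \<open>\<open>sup_norm\<close> is a real supremum and is known to dominate the values
    of \<open>f\<close> only once these are bounded.\<close>
  then have "bdd_above (range (\<lambda>x. norm (f x)))"
    by (auto simp: bdd_above_def)
  then have "norm (f x) \<le> sup_norm f"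
    unfolding sup_norm_def by (rule cSUP_upper[rotated]) simp
  then show ?thesis
    using le by simp
qed

lemma op_norm_leI:
  assumes "\<And>f. f \<in> X \<Longrightarrow> A f \<in> Y" and "\<And>f. f \<in> X \<Longrightarrow> normX f \<le> 1 \<Longrightarrow> normY (A f) \<le> B"
  shows "op_norm X normX Y normY A \<le> ennreal B"
  unfolding op_norm_def using assms by (auto intro!: SUP_least ennreal_leI)

text \<open>Applying ln y \<le> y to the square root of \<open>n\<close> makes the factor n^2 log^2
  n of the squared L2 part O(n^3).\<close>

lemma ln_squared_le:
  assumes "n > 0"
  shows "(ln (real n))\<^sup>2 \<le> 4 * real n"
proof -
  have "ln (real n) = 2 * ln (sqrt (real n))"
    using assms by (simp add: ln_sqrt)
  also have "\<dots> \<le> 2 * sqrt (real n)"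
    using ln_le_minus_one[of "sqrt (real n)"] assms by simp
  finally have "(ln (real n))\<^sup>2 \<le> (2 * sqrt (real n))\<^sup>2"
    using assms by (intro power_mono) auto
  then show ?thesis
    by (simp add: power_mult_distrib)
qed

lemma interp_op_sup_norm:
  assumes "\<beta> > 0" "n > 0" "\<And>x. norm (f x) \<le> 1"
  shows "sup_norm (interp_op \<beta> n f) \<le> 8 * harm n"
  unfolding sup_norm_def by (rule cSUP_least) (auto intro: norm_interp_op_le[OF assms])

lemma interp_op_L2_norm:
  assumes \<beta>: "\<beta> > 0" and n: "n > 0" and f: "\<And>x. norm (f x) \<le> 1"
  shows "L2_norm (interp_op \<beta> n f) \<le> real n * (8 * harm n) * sqrt (4 * pi * \<beta>)"
proof -
  have "L2_norm (interp_op \<beta> n f) \<le> sqrt ((real n * (8 * harm n))\<^sup>2 * (4 * pi * \<beta>))"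
    unfolding L2_norm_def by (rule real_sqrt_le_mono[OF interp_op_L2[OF assms]])
  also have "\<dots> = real n * (8 * harm n) * sqrt (4 * pi * \<beta>)"
    by (subst real_sqrt_mult) (simp add: harm_nonneg)
  finally show ?thesis .
qed

lemma interp_op_H1_norm:
  assumes \<beta>: "\<beta> > 0" and n: "n \<ge> 2" and f: "\<And>x. norm (f x) \<le> 1"
  shows "H1_norm (interp_op \<beta> n f)
    \<le> sqrt (4 * pi * (256 * (1 + 1 / ln 2)\<^sup>2 * (4 * pi * \<beta>) + 4 * pi / \<beta>)) * real n powr (3/2)"
proof -
  define K :: real where "K = 1 + 1 / ln 2"
  have n0: "n > 0"
    using n by simp
  have "(harm n)\<^sup>2 \<le> (K * ln (real n))\<^sup>2"
    using harm_le_ln[OF n] by (intro power_mono) (auto simp: K_def harm_nonneg)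
  also have "\<dots> \<le> K\<^sup>2 * (4 * real n)"
    unfolding power_mult_distrib using ln_squared_le[OF n0] by (intro mult_left_mono) auto
  \<comment> \<open>The later 256 is 64, from the square of \<open>8 * harm n\<close>, times 4 from
    \<open>ln_squared_le\<close>.\<close>
  finally have "64 * (real n)\<^sup>2 * (harm n)\<^sup>2 \<le> 64 * (real n)\<^sup>2 * (K\<^sup>2 * (4 * real n))"
    by (intro mult_left_mono) auto
  then have "(real n * (8 * harm n))\<^sup>2 \<le> 256 * K\<^sup>2 * real n ^ 3"
    by (simp add: power_mult_distrib power2_eq_square power3_eq_cube mult_ac)
  then have "4 * pi * ((real n * (8 * harm n))\<^sup>2 * (4 * pi * \<beta>) + 4 * pi / \<beta> * real n ^ 3)
      \<le> 4 * pi * (256 * K\<^sup>2 * real n ^ 3 * (4 * pi * \<beta>) + 4 * pi / \<beta> * real n ^ 3)"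
    using \<beta> by (intro mult_left_mono add_right_mono mult_right_mono) auto
  also have "\<dots> = 4 * pi * (256 * K\<^sup>2 * (4 * pi * \<beta>) + 4 * pi / \<beta>) * real n ^ 3"
    by (simp add: distrib_left distrib_right mult_ac)
  finally have "sqrt (4 * pi * ((real n * (8 * harm n))\<^sup>2 * (4 * pi * \<beta>) + 4 * pi / \<beta> * real n ^ 3))
      \<le> sqrt (4 * pi * (256 * K\<^sup>2 * (4 * pi * \<beta>) + 4 * pi / \<beta>) * real n ^ 3)"
    by (rule real_sqrt_le_mono)
  with interp_op_H1(2)[OF \<beta> n0 f]
  have "H1_norm (interp_op \<beta> n f) \<le> sqrt (4 * pi * (256 * K\<^sup>2 * (4 * pi * \<beta>) + 4 * pi / \<beta>) * real n ^ 3)"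
    by (rule order_trans)
  also have "\<dots> = sqrt (4 * pi * (256 * K\<^sup>2 * (4 * pi * \<beta>) + 4 * pi / \<beta>)) * sqrt (real n ^ 3)"
    by (rule real_sqrt_mult)
  also have "sqrt (real n ^ 3) = (real n powr 3) powr (1/2)"
    using n0 by (simp add: powr_half_sqrt powr_realpow[of "real n" 3, simplified])
  also have "\<dots> = real n powr (3/2)"
    by (subst powr_powr) simp
  finally show ?thesis
    unfolding K_def .
qed

theorem theorem5p1:
  fixes \<beta> :: real
  assumes "\<beta> > 0"
  shows "(\<exists>C::real. \<forall>n::nat. n > 1 \<longrightarrow>
            op_norm C0_space sup_norm C0_space sup_norm (interp_op \<beta> n)
              \<le> ennreal (C * ln (real n)))
       \<and> (\<exists>C::real. \<forall>n::nat. n > 1 \<longrightarrow>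
            op_norm C0_space sup_norm L2_space L2_norm (interp_op \<beta> n)
              \<le> ennreal (C * real n * ln (real n)))
       \<and> (\<exists>C::real. \<forall>n::nat. n > 1 \<longrightarrow>
            op_norm C0_space sup_norm H1_space H1_norm (interp_op \<beta> n)
              \<le> ennreal (C * real n powr (3/2)))
       \<and> (\<exists>C::real. \<forall>n::nat. n > 1 \<longrightarrow>
            op_norm H1_space H1_norm H1_space H1_norm (interp_op \<beta> n)
              \<le> ennreal (C * real n powr (3/2)))"
proof (intro conjI)
  define K :: real where "K = 1 + 1 / ln 2"
  have K: "harm n \<le> K * ln (real n)" if "n > 1" for n
    using harm_le_ln[of n] that by (simp add: K_def)
  \<comment> \<open>\<open>op_norm\<close> is finite only if the whole domain is mapped into the
    target, so membership is secured for every \<open>f\<close> beforehand.\<close>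
  have H1: "interp_op \<beta> n f \<in> H1_space" if "n > 1" for n f
    using fourier_pair_interp_op[OF assms, of n f] interp_op_deriv[OF assms, of n f] that
      fourier_pair_H1(1) by force
  show "\<exists>C. \<forall>n>1. op_norm C0_space sup_norm C0_space sup_norm (interp_op \<beta> n) \<le> ennreal (C * ln (real n))"
  proof (intro exI[of _ "8 * K"] allI impI op_norm_leI)
    fix n :: nat and f assume n: "n > 1"
    then show "interp_op \<beta> n f \<in> C0_space"
      by (intro interp_op_C0[OF assms]) simp
    assume "f \<in> C0_space" "sup_norm f \<le> 1"
    then have "sup_norm (interp_op \<beta> n f) \<le> 8 * harm n"
      using n by (intro interp_op_sup_norm[OF assms] sup_norm_le_1_imp_norm_le_1) auto
    then show "sup_norm (interp_op \<beta> n f) \<le> 8 * K * ln (real n)"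
      using K[OF n] by simp
  qed
  show "\<exists>C. \<forall>n>1. op_norm C0_space sup_norm L2_space L2_norm (interp_op \<beta> n) \<le> ennreal (C * real n * ln (real n))"
  proof (intro exI[of _ "8 * K * sqrt (4 * pi * \<beta>)"] allI impI op_norm_leI)
    fix n :: nat and f assume n: "n > 1"
    then show "interp_op \<beta> n f \<in> L2_space"
      using H1 by (simp add: H1_space_def)
    assume "f \<in> C0_space" "sup_norm f \<le> 1"
    then have "L2_norm (interp_op \<beta> n f) \<le> real n * (8 * harm n) * sqrt (4 * pi * \<beta>)"
      using n by (intro interp_op_L2_norm[OF assms] sup_norm_le_1_imp_norm_le_1) auto
    also have "\<dots> \<le> real n * (8 * (K * ln (real n))) * sqrt (4 * pi * \<beta>)"
      using K[OF n] assms by (intro mult_right_mono mult_left_mono) auto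
    finally show "L2_norm (interp_op \<beta> n f) \<le> 8 * K * sqrt (4 * pi * \<beta>) * real n * ln (real n)"
      by (simp only: mult_ac)
  qed
  define C where "C = sqrt (4 * pi * (256 * (1 + 1 / ln 2)\<^sup>2 * (4 * pi * \<beta>) + 4 * pi / \<beta>))"
  show "\<exists>C. \<forall>n>1. op_norm C0_space sup_norm H1_space H1_norm (interp_op \<beta> n) \<le> ennreal (C * real n powr (3/2))"
  proof (intro exI[of _ C] allI impI op_norm_leI H1)
    fix n :: nat and f assume "n > 1" "f \<in> C0_space" "sup_norm f \<le> 1"
    then show "H1_norm (interp_op \<beta> n f) \<le> C * real n powr (3/2)"
      unfolding C_def by (intro interp_op_H1_norm[OF assms] sup_norm_le_1_imp_norm_le_1) auto
  qed
  show "\<exists>C. \<forall>n>1. op_norm H1_space H1_norm H1_space H1_norm (interp_op \<beta> n) \<le> ennreal (C * real n powr (3/2))"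
  \<comment> \<open>The constant of the preceding estimate serves again, since the unit ball of H1
    consists of functions bounded by 1.\<close>
  proof (intro exI[of _ C] allI impI op_norm_leI H1)
    fix n :: nat and f assume "n > 1" "f \<in> H1_space" "H1_norm f \<le> 1"
    then show "H1_norm (interp_op \<beta> n f) \<le> C * real n powr (3/2)"
      unfolding C_def by (intro interp_op_H1_norm[OF assms] H1_norm_le_1_imp_norm_le_1) auto
  qed
qed

end
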